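(* Let $\mathcal{D}$ be the generating class of a decomposable model for $m$-way contingency tables. Let $\mathcal{B}_{\mathrm{nd}}=\{\mathbf{b}\mid \deg\mathbf{b}=2,\ |\mathcal{F}_{\mathbf{b}}|\ge 2\}$. For each $\mathbf{b}\in\mathcal{B}_{\mathrm{nd}}$ let $\mathcal{T}_{\mathbf{b}}$ be any tree whose set of nodes is $\mathcal{F}_{\mathbf{b}}$, and let $\mathcal{M}_{\mathcal{T}_{\mathbf{b}}}$ be the set of moves $\mathbf{n}-\mathbf{n}'$ corresponding to the edges $(\mathbf{n},\mathbf{n}')$ of $\mathcal{T}_{\mathbf{b}}$. Then $$\mathcal{M}^0=\bigcup_{\mathbf{b}\in\mathcal{B}_{\mathrm{nd}}}\mathcal{M}_{\mathcal{T}_{\mathbf{b}}}$$ is a minimal Markov basis, and this union is disjoint. Conversely, every minimal Markov basis can be written in this form (for some choice of trees $\mathcal{T}_{\mathbf{b}}$, $\mathbf{b}\in\mathcal{B}_{\mathrm{nd}}$).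
   Context: Let $\Delta=\{1,\dots,m\}$ be the set of variables; variable $\delta$ has level set $\mathcal{I}_\delta=\{0,1,\dots,I_\delta-1\}$, and the cells are $i=(i_1,\dots,i_m)\in\mathcal{I}=\prod_{\delta\in\Delta}\mathcal{I}_\delta$. A contingency table is a nonnegative integer array $\mathbf{n}=\{n(i)\}_{i\in\mathcal{I}}$; its sample size is $\sum_i n(i)$. For $D\subset\Delta$, $\mathcal{I}_D=\prod_{\delta\in D}\mathcal{I}_\delta$, and the $D$-marginal table $\mathbf{n}_D$ has entries $n_D(i_D)=\sum_{i_{D^C}\in\mathcal{I}_{D^C}}n(i_D,i_{D^C})$. The generating class $\mathcal{D}=\{D_1,\dots,D_r\}$ is the set of facets of a simplicial complex with $\bigcup_jD_j=\Delta$. The independence graph $\mathcal{G}^{\mathcal{D}}$ has vertex set $\Delta$, with distinct $\delta,\delta'$ adjacent iff $\delta,\delta'\in D$ for some $D\in\mathcal{D}$. The model is decomposable if $\mathcal{D}$ is the set of maximal cliques of $\mathcal{G}^{\mathcal{D}}$ and $\mathcal{G}^{\mathcal{D}}$ is chordal (every cycle of length greater than three has a chord). The marginal frequencies of $\mathbf{n}$ are $\mathbf{b}=A\mathbf{n}=\{n_{D_j}(i_{D_j}) : i_{D_j}\in\mathcal{I}_{D_j},\ j=1,\dots,r\}$, and the fiber is $\mathcal{F}_{\mathbf{b}}=\{\mathbf{n}\ge 0\mid A\mathbf{n}=\mathbf{b}\}$; $\deg\mathbf{b}$ is the common sample size of the tables in $\mathcal{F}_{\mathbf{b}}$. A move is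 an integer array $\mathbf{z}=\{z(i)\}_{i\in\mathcal{I}}$ with $A\mathbf{z}=\mathbf{0}$. A finite set $\mathcal{M}$ of moves is a Markov basis if for every fiber $\mathcal{F}_{\mathbf{b}}$, any two elements of $\mathcal{F}_{\mathbf{b}}$ can be joined by a finite sequence of elements of $\mathcal{F}_{\mathbf{b}}$ in which consecutive tables differ by $\pm\mathbf{z}$ with $\mathbf{z}\in\mathcal{M}$. A Markov basis is minimal if no proper subset of it is a Markov basis. Moves are considered up to sign: $\mathbf{z}$ is identified with $-\mathbf{z}$ (so edges of $\mathcal{T}_{\mathbf{b}}$ are undirected). *)

theory Defs
  imports "HOL-Library.FuncSet" "HOL-Library.Disjoint_Sets"
begin

text \<open>A graph is a vertex set \<open>V\<close> with a set \<open>E\<close> of two-element subsets of \<open>V\<close>.\<close>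

definition simple_graph :: "'a set \<Rightarrow> 'a set set \<Rightarrow> bool" where
  "simple_graph V E \<longleftrightarrow> (\<forall>e\<in>E. \<exists>u\<in>V. \<exists>v\<in>V. u \<noteq> v \<and> e = {u, v})"

definition connected_graph :: "'a set \<Rightarrow> 'a set set \<Rightarrow> bool" where
  "connected_graph V E \<longleftrightarrow> V \<noteq> {} \<and> (\<forall>u\<in>V. \<forall>v\<in>V. (u, v) \<in> {(x, y). {x, y} \<in> E}\<^sup>*)"

text \<open>A cycle is given by the list of its distinct vertices in cyclic order; the first vertex
  is not repeated at the end.\<close>

definition graph_cycle :: "'a set set \<Rightarrow> 'a list \<Rightarrow> bool" where
  "graph_cycle E xs \<longleftrightarrow> 3 \<le> length xs \<and> distinct xs \<and>
     (\<forall>k<length xs. {xs ! k, xs ! (Suc k mod length xs)} \<in> E)"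

definition has_chord :: "'a set set \<Rightarrow> 'a list \<Rightarrow> bool" where
  "has_chord E xs \<longleftrightarrow> (\<exists>j<length xs. \<exists>k<length xs. j \<noteq> k \<and>
     Suc j mod length xs \<noteq> k \<and> Suc k mod length xs \<noteq> j \<and> {xs ! j, xs ! k} \<in> E)"

definition chordal :: "'a set set \<Rightarrow> bool" where
  "chordal E \<longleftrightarrow> (\<forall>xs. graph_cycle E xs \<and> length xs > 3 \<longrightarrow> has_chord E xs)"

definition is_tree :: "'a set \<Rightarrow> 'a set set \<Rightarrow> bool" where
  "is_tree V E \<longleftrightarrow> simple_graph V E \<and> connected_graph V E \<and> (\<nexists>xs. graph_cycle E xs)"

definition clique :: "'a set \<Rightarrow> 'a set set \<Rightarrow> 'a set \<Rightarrow> bool" where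
  "clique V E C \<longleftrightarrow> C \<subseteq> V \<and> (\<forall>u\<in>C. \<forall>v\<in>C. u \<noteq> v \<longrightarrow> {u, v} \<in> E)"

definition maximal_cliques :: "'a set \<Rightarrow> 'a set set \<Rightarrow> 'a set set" where
  "maximal_cliques V E = {C. clique V E C \<and> (\<nexists>C'. clique V E C' \<and> C \<subset> C')}"

definition abstract_complex :: "'a set \<Rightarrow> 'a set set \<Rightarrow> bool" where
  "abstract_complex V K \<longleftrightarrow> K \<subseteq> Pow V \<and> (\<forall>F\<in>K. \<forall>F'. F' \<subseteq> F \<longrightarrow> F' \<in> K)"

definition facets :: "'a set set \<Rightarrow> 'a set set" where
  "facets K = {F \<in> K. \<nexists>F'. F' \<in> K \<and> F \<subset> F'}"

definition generating_class :: "'a set \<Rightarrow> 'a set set \<Rightarrow> bool" where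
  "generating_class V \<D> \<longleftrightarrow> (\<exists>K. abstract_complex V K \<and> \<D> = facets K) \<and> \<Union>\<D> = V"

definition independence_graph :: "'a set set \<Rightarrow> 'a set set" where
  "independence_graph \<D> = {{d, d'} | d d'. d \<noteq> d' \<and> (\<exists>D\<in>\<D>. d \<in> D \<and> d' \<in> D)}"

definition decomposable :: "'a set \<Rightarrow> 'a set set \<Rightarrow> bool" where
  "decomposable V \<D> \<longleftrightarrow>
     \<D> = maximal_cliques V (independence_graph \<D>) \<and> chordal (independence_graph \<D>)"

text \<open>The variables are \<open>1, \<dots>, m\<close>, and variable \<open>d\<close> has the levels \<open>0, \<dots>, I d - 1\<close>.
  A (marginal) cell is an extensional function on its set of variables.\<close>

type_synonym cell = "nat \<Rightarrow> nat"
type_synonym table = "cell \<Rightarrow> int"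

definition cells :: "(nat \<Rightarrow> nat) \<Rightarrow> nat set \<Rightarrow> cell set" where
  "cells I D = (\<Pi>\<^sub>E d\<in>D. {0..<I d})"

text \<open>Arrays indexed by the cells vanish outside the cells, so that equality of functions is
  equality of arrays.\<close>

definition arrays :: "nat \<Rightarrow> (nat \<Rightarrow> nat) \<Rightarrow> table set" where
  "arrays m I = {z. \<forall>i. i \<notin> cells I {1..m} \<longrightarrow> z i = 0}"

definition tables :: "nat \<Rightarrow> (nat \<Rightarrow> nat) \<Rightarrow> table set" where
  "tables m I = {n \<in> arrays m I. \<forall>i. 0 \<le> n i}"

definition sample_size :: "nat \<Rightarrow> (nat \<Rightarrow> nat) \<Rightarrow> table \<Rightarrow> int" where
  "sample_size m I n = (\<Sum>i\<in>cells I {1..m}. n i)"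

definition marginal :: "nat \<Rightarrow> (nat \<Rightarrow> nat) \<Rightarrow> nat set \<Rightarrow> table \<Rightarrow> table" where
  "marginal m I D n j = (\<Sum>k\<in>cells I ({1..m} - D). n (\<lambda>d. if d \<in> D then j d else k d))"

text \<open>The linear map \<open>A\<close>: the entry of \<open>A n\<close> at \<open>(D, j)\<close>, for \<open>D\<close> in the generating class and
  \<open>j\<close> a \<open>D\<close>-marginal cell, is the marginal frequency; all other positions are filled with zero.\<close>

type_synonym frequencies = "nat set \<Rightarrow> cell \<Rightarrow> int"

definition margins :: "nat \<Rightarrow> (nat \<Rightarrow> nat) \<Rightarrow> nat set set \<Rightarrow> table \<Rightarrow> frequencies" where
  "margins m I \<D> n = (\<lambda>D j. if D \<in> \<D> \<and> j \<in> cells I D then marginal m I D n j else 0)"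

definition fiber :: "nat \<Rightarrow> (nat \<Rightarrow> nat) \<Rightarrow> nat set set \<Rightarrow> frequencies \<Rightarrow> table set" where
  "fiber m I \<D> b = {n \<in> tables m I. margins m I \<D> n = b}"

text \<open>The common sample size of the tables in the fiber; unspecified if the fiber is empty.\<close>

definition deg :: "nat \<Rightarrow> (nat \<Rightarrow> nat) \<Rightarrow> nat set set \<Rightarrow> frequencies \<Rightarrow> int" where
  "deg m I \<D> b = (THE s. sample_size m I ` fiber m I \<D> b = {s})"

definition moves :: "nat \<Rightarrow> (nat \<Rightarrow> nat) \<Rightarrow> nat set set \<Rightarrow> table set" where
  "moves m I \<D> = {z \<in> arrays m I. \<forall>D j. margins m I \<D> z D j = 0}"

text \<open>A move up to sign is the set consisting of the move and its negative; sets of moves up to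
  sign are sets of such classes.\<close>

definition up_to_sign :: "table \<Rightarrow> table set" where
  "up_to_sign z = {z, - z}"

definition markov_basis :: "nat \<Rightarrow> (nat \<Rightarrow> nat) \<Rightarrow> nat set set \<Rightarrow> table set set \<Rightarrow> bool" where
  "markov_basis m I \<D> M \<longleftrightarrow> finite M \<and> M \<subseteq> up_to_sign ` moves m I \<D> \<and>
     (\<forall>b. \<forall>n\<in>fiber m I \<D> b. \<forall>n'\<in>fiber m I \<D> b.
        (n, n') \<in> {(x, y). x \<in> fiber m I \<D> b \<and> y \<in> fiber m I \<D> b \<and> up_to_sign (x - y) \<in> M}\<^sup>*)"

definition minimal_markov_basis ::
    "nat \<Rightarrow> (nat \<Rightarrow> nat) \<Rightarrow> nat set set \<Rightarrow> table set set \<Rightarrow> bool" where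
  "minimal_markov_basis m I \<D> M \<longleftrightarrow>
     markov_basis m I \<D> M \<and> (\<forall>M'. M' \<subset> M \<longrightarrow> \<not> markov_basis m I \<D> M')"

text \<open>Fibers are finite for a generating class (see \<open>finite_fiber\<close> below), so \<open>card\<close> really
  counts tables here.\<close>

definition B_nd :: "nat \<Rightarrow> (nat \<Rightarrow> nat) \<Rightarrow> nat set set \<Rightarrow> frequencies set" where
  "B_nd m I \<D> = {b. deg m I \<D> b = 2 \<and> 2 \<le> card (fiber m I \<D> b)}"

definition edge_moves :: "table set set \<Rightarrow> table set set" where
  "edge_moves E = {up_to_sign (n - n') | n n'. {n, n'} \<in> E}"

lemma finite_cells: "finite D \<Longrightarrow> finite (cells I D)"
  unfolding cells_def by (intro finite_PiE) auto

lemma sum_marginal: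
  assumes "D \<subseteq> {1..m}"
  shows "(\<Sum>j\<in>cells I D. marginal m I D n j) = sample_size m I n"
proof -
  let ?g = "\<lambda>(j, k) d. if d \<in> D then j d else k d :: nat"
  have "bij_betw ?g (cells I D \<times> cells I ({1..m} - D)) (cells I {1..m})"
  proof (rule bij_betw_byWitness[where f' = "\<lambda>i. (restrict i D, restrict i ({1..m} - D))"])
    show "\<forall>a\<in>cells I D \<times> cells I ({1..m} - D).
        (restrict (?g a) D, restrict (?g a) ({1..m} - D)) = a"
      by (auto simp: cells_def PiE_def extensional_def fun_eq_iff restrict_def)
    show "\<forall>i\<in>cells I {1..m}. ?g (restrict i D, restrict i ({1..m} - D)) = i"
      by (auto simp: cells_def PiE_def extensional_def fun_eq_iff restrict_def)
    show "?g ` (cells I D \<times> cells I ({1..m} - D)) \<subseteq> cells I {1..m}"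
      using assms by (auto simp: cells_def PiE_def Pi_def extensional_def)
    show "(\<lambda>i. (restrict i D, restrict i ({1..m} - D))) ` cells I {1..m}
        \<subseteq> cells I D \<times> cells I ({1..m} - D)"
      using assms by (auto simp: cells_def PiE_def Pi_def extensional_def)
  qed
  from sum.reindex_bij_betw[OF this, of n] show ?thesis
    by (simp add: marginal_def sample_size_def sum.cartesian_product case_prod_unfold)
qed

lemma decomposable_nonempty: "decomposable {1..m::nat} \<D> \<Longrightarrow> \<D> \<noteq> {}"
proof
  assume *: "decomposable {1..m} \<D>" "\<D> = {}"
  then have "independence_graph \<D> = {}" "maximal_cliques {1..m} {} = {}"
    by (auto simp: decomposable_def independence_graph_def)
  moreover have "(if m = 0 then {} else {1}) \<in> maximal_cliques {1..m} {}"
    by (auto simp: maximal_cliques_def clique_def)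
  ultimately show False by simp
qed

lemma sample_size_eq_on_fiber:
  assumes "generating_class {1..m} \<D>" "\<D> \<noteq> {}" "n \<in> fiber m I \<D> b" "n' \<in> fiber m I \<D> b"
  shows "sample_size m I n = sample_size m I n'"
proof -
  obtain D where D: "D \<in> \<D>" using assms by auto
  then have sub: "D \<subseteq> {1..m}" using assms(1) by (auto simp: generating_class_def)
  have "marginal m I D n j = marginal m I D n' j" if "j \<in> cells I D" for j
  proof -
    have "margins m I \<D> n D j = margins m I \<D> n' D j"
      using assms(3,4) by (simp add: fiber_def)
    then show ?thesis using D that by (simp add: margins_def)
  qed
  then show ?thesis by (simp flip: sum_marginal[OF sub])
qed

lemma deg_eq_sample_size:
  assumes "generating_class {1..m} \<D>" "\<D> \<noteq> {}" "n \<in> fiber m I \<D> b"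
  shows "deg m I \<D> b = sample_size m I n"
proof -
  have "sample_size m I ` fiber m I \<D> b = {sample_size m I n}"
    using assms(3) sample_size_eq_on_fiber[OF assms(1,2)] by blast
  then show ?thesis by (simp add: deg_def)
qed

lemma finite_fiber:
  assumes "generating_class {1..m} \<D>" "\<D> \<noteq> {}"
  shows "finite (fiber m I \<D> b)"
proof (cases "fiber m I \<D> b = {}")
  case False
  then obtain n0 where n0: "n0 \<in> fiber m I \<D> b" by auto
  have "n i \<in> {0..sample_size m I n0}" if n: "n \<in> fiber m I \<D> b" and i: "i \<in> cells I {1..m}" for n i
  proof -
    have pos: "0 \<le> n k" for k using n by (auto simp: fiber_def tables_def)
    then have "n i \<le> sample_size m I n"
      unfolding sample_size_def by (intro member_le_sum i finite_cells) auto
    then show ?thesis using pos sample_size_eq_on_fiber[OF assms n n0] by simp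
  qed
  then have "fiber m I \<D> b \<subseteq> {n. \<forall>i. (i \<in> cells I {1..m} \<longrightarrow> n i \<in> {0..sample_size m I n0})
      \<and> (i \<notin> cells I {1..m} \<longrightarrow> n i = 0)}"
    by (auto simp: fiber_def tables_def arrays_def)
  then show ?thesis
    by (rule finite_subset) (intro finite_set_of_finite_funs finite_cells; simp)
qed simp

end

theory Submission
  imports Defs "HOL-Library.Function_Algebras"
begin

text \<open>Call a set \<open>H\<close> of variables clique-bounded if every component of its complement has a clique as
  set of neighbours in \<open>H\<close>. Chordality yields, in each such component \<open>C\<close>, a vertex \<open>v\<close> adjacent to
  all of these neighbours, and then \<open>insert v H\<close> is clique-bounded again. If two tables of a fiber
  agree in their \<open>H\<close>-margins but not in their \<open>insert v H\<close>-margins, choose two cells of the first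
  table that agree on the neighbours of \<open>C\<close> and swap their \<open>C\<close>-coordinates; this is a
  move of degree two, since each facet lies in \<open>C\<close> and its neighbours or misses \<open>C\<close>, and a suitable
  choice decreases the \<open>L\<^sup>1\<close>-distance of the margins. Growing \<open>H\<close> from the empty set to all
  variables shows that moves of degree two connect every fiber.

  Distinct tables in a fiber of degree two have disjoint supports, so the move of an edge determines
  the edge and the fiber. Hence a Markov basis contained in \<open>\<M>\<^sup>0\<close> has to contain every tree edge, and
  a minimal Markov basis is the basis obtained from spanning trees of the graphs it induces on the
  fibers of degree two.\<close>

subsection \<open>Trees\<close>

text \<open>Among all walks from \<open>a\<close> to some vertex satisfying \<open>P\<close>, take
  one of least length: a repeated vertex, an earlier vertex satisfying \<open>P\<close> or a
  shortcut would give a shorter one.\<close>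

lemma shortest_path:
  assumes "(a, b) \<in> R\<^sup>*" "P b"
  obtains p n where "p 0 = a" "P (p n)" "\<And>i. i < n \<Longrightarrow> (p i, p (Suc i)) \<in> R"
    "inj_on p {..n}" "\<And>i. i < n \<Longrightarrow> \<not> P (p i)"
    "\<And>i j. Suc i < j \<Longrightarrow> j \<le> n \<Longrightarrow> (p i, p j) \<notin> R"
proof -
  define Q where "Q n \<longleftrightarrow> (\<exists>c. (a, c) \<in> R ^^ n \<and> P c)" for n
  define n where "n = (LEAST n. Q n)"
  have ex: "\<exists>n. Q n"
    using assms by (auto simp: Q_def rtrancl_power)
  then have "Q n" unfolding n_def by (rule LeastI_ex)
  have least: "n \<le> k" if "Q k" for k
    using that unfolding n_def by (rule Least_le)
  obtain p where p: "p 0 = a" "P (p n)" "\<And>i. i < n \<Longrightarrow> (p i, p (Suc i)) \<in> R"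
    using \<open>Q n\<close> unfolding Q_def relpow_fun_conv by blast
  have seg: "(p i, p (i + k)) \<in> R ^^ k" if "i + k \<le> n" for i k
    unfolding relpow_fun_conv
    by (rule exI[of _ "\<lambda>l. p (i + l)"]) (use p(3) that in auto)
  \<comment> \<open>Replaces the stretch from \<open>p i\<close> to \<open>p j\<close> by
    \<open>k\<close> steps; \<open>k = 0\<close> rules out repetitions, \<open>k = 1\<close>
    shortcuts.\<close>
  have join: "Q (i + k + (n - j))" if "i \<le> n" "j \<le> n" "(p i, p j) \<in> R ^^ k" for i j k
  proof -
    have "(a, p i) \<in> R ^^ i" using seg[of 0 i] that p(1) by simp
    moreover have "(p j, p n) \<in> R ^^ (n - j)" using seg[of j "n - j"] that by simp
    ultimately have "(a, p n) \<in> R ^^ (i + k + (n - j))"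
      using that(3) by (auto simp: relpow_add)
    then show ?thesis using p(2) by (auto simp: Q_def)
  qed
  have no_rep: "p i \<noteq> p j" if "i < j" "j \<le> n" for i j
    using least[OF join[of i j 0]] that by auto
  have "inj_on p {..n}"
    using no_rep by (intro linorder_inj_onI) (auto simp: atMost_def)
  moreover have "\<not> P (p i)" if "i < n" for i
  proof
    assume "P (p i)"
    then have "Q i" using seg[of 0 i] that p(1) by (auto simp: Q_def)
    then show False using least that by fastforce
  qed
  moreover have "(p i, p j) \<notin> R" if "Suc i < j" "j \<le> n" for i j
    using least[OF join[of i j 1]] that by auto
  ultimately show ?thesis using p that by blast
qed

text \<open>A shortest detour from \<open>a\<close> to \<open>b\<close> would close up with the edge
  itself to a cycle.\<close>

lemma tree_edge_bridge:
  assumes "is_tree V E" "{a, b} \<in> E"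
  shows "(a, b) \<notin> {(x, y). {x, y} \<in> E - {{a, b}}}\<^sup>*"
proof
  let ?R = "{(x, y). {x, y} \<in> E - {{a, b}}}"
  assume "(a, b) \<in> ?R\<^sup>*"
  then obtain p n where p: "p 0 = a" "p n = b" "\<And>i. i < n \<Longrightarrow> (p i, p (Suc i)) \<in> ?R"
    "inj_on p {..n}"
    by (rule shortest_path[where P = "\<lambda>c. c = b"]) auto
  have "a \<noteq> b"
    using assms by (force simp: is_tree_def simple_graph_def doubleton_eq_iff)
  \<comment> \<open>A detour of length one would be the deleted edge, so the closed walk has the
    three vertices that \<open>graph_cycle\<close> demands.\<close>
  have "n \<noteq> 0" using p(1,2) \<open>a \<noteq> b\<close> by (cases n) auto
  moreover have "n \<noteq> 1" using p(1,2) p(3)[of 0] by auto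
  ultimately have n: "2 \<le> n" by linarith
  have "graph_cycle E (map p [0..<Suc n])"
    unfolding graph_cycle_def
  proof (intro conjI allI impI)
    show "distinct (map p [0..<Suc n])"
      using p(4) by (simp add: distinct_map atLeast0LessThan lessThan_Suc_atMost del: upt_Suc)
    fix k assume k: "k < length (map p [0..<Suc n])"
    show "{map p [0..<Suc n] ! k, map p [0..<Suc n] ! (Suc k mod length (map p [0..<Suc n]))} \<in> E"
    proof (cases "k = n")
      case True
      then show ?thesis using p(1,2) assms(2) by (simp add: insert_commute del: upt_Suc)
    next
      case False
      then show ?thesis using p(3)[of k] k by (simp add: nth_append del: upt_Suc)
    qed
  qed (use n in simp)
  then show False using assms(1) by (auto simp: is_tree_def)
qed

text \<open>Take a connected subgraph with the fewest edges: an edge on a cycle could be dropped,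
  since the rest of the cycle replaces it.\<close>

lemma spanning_tree:
  assumes "connected_graph V E" "simple_graph V E" "finite E"
  obtains F where "F \<subseteq> E" "is_tree V F"
proof -
  obtain F where F: "F \<subseteq> E" "connected_graph V F"
    and min: "\<And>F'. F' \<subseteq> E \<Longrightarrow> connected_graph V F' \<Longrightarrow> card F \<le> card F'"
    using ex_has_least_nat[of "\<lambda>F. F \<subseteq> E \<and> connected_graph V F" E card] assms(1) by blast
  have "finite F" using F(1) assms(3) finite_subset by blast
  have "\<not> graph_cycle F xs" for xs
  proof
    assume "graph_cycle F xs"
    then obtain n where n: "length xs = Suc n" "2 \<le> n" and dist: "distinct xs"
      and edge: "\<And>k. k < Suc n \<Longrightarrow> {xs ! k, xs ! (Suc k mod Suc n)} \<in> F"
      unfolding graph_cycle_def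
      by (metis One_nat_def Suc_1 Suc_le_D Suc_le_mono numeral_3_eq_3)
    define e where "e = {xs ! n, xs ! 0}"
    have e: "e \<in> F" using edge[of n] by (simp add: e_def)
    define R where "R = {(x, y). {x, y} \<in> F - {e}}"
    have step: "(xs ! k, xs ! Suc k) \<in> R" if "k < n" for k
    proof -
      have "{xs ! k, xs ! Suc k} \<noteq> e"
        using that n dist by (auto simp: e_def doubleton_eq_iff nth_eq_iff_index_eq)
      then show ?thesis using edge[of k] that by (simp add: R_def)
    qed
    have "(xs ! 0, xs ! k) \<in> R\<^sup>*" if "k \<le> n" for k
      using that by (induction k) (auto simp: Suc_le_eq intro: rtrancl_into_rtrancl step)
    then have path: "(xs ! 0, xs ! n) \<in> R\<^sup>*" by blast
    have "sym (R\<^sup>*)" by (intro sym_rtrancl) (auto simp: sym_def R_def insert_commute)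
    then have "(x, y) \<in> R\<^sup>*" if "{x, y} \<in> F" for x y
      using that path
      by (cases "{x, y} = e") (auto simp: e_def doubleton_eq_iff R_def dest: symD)
    then have "{(x, y). {x, y} \<in> F} \<subseteq> R\<^sup>*" by auto
    then have "{(x, y). {x, y} \<in> F}\<^sup>* \<subseteq> R\<^sup>*"
      by (metis rtrancl_mono rtrancl_idemp)
    then have "connected_graph V (F - {e})"
      using F(2) unfolding connected_graph_def R_def by blast
    then have "card F \<le> card (F - {e})" using min F(1) by blast
    then show False using e \<open>finite F\<close> by (metis card_Diff1_less linorder_not_less)
  qed
  moreover have "simple_graph V F" using F(1) assms(2) by (auto simp: simple_graph_def)
  ultimately show ?thesis using F that unfolding is_tree_def by blast
qed

subsection \<open>Chordal graphs\<close>

text \<open>Adjacency in the graph induced on the complement of \<open>H\<close>; outside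
  \<open>H\<close>, the classes of its reflexive transitive closure are the components.\<close>

definition outside :: "'a set set \<Rightarrow> 'a set \<Rightarrow> ('a \<times> 'a) set" where
  "outside E H = {(x, y). {x, y} \<in> E \<and> x \<notin> H \<and> y \<notin> H}"

definition boundary :: "'a set set \<Rightarrow> 'a set \<Rightarrow> 'a \<Rightarrow> 'a set" where
  "boundary E H x = {s \<in> H. \<exists>y. (x, y) \<in> (outside E H)\<^sup>* \<and> {y, s} \<in> E}"

definition clique_bounded :: "'a set set \<Rightarrow> 'a set \<Rightarrow> bool" where
  "clique_bounded E H \<longleftrightarrow> (\<forall>x. x \<notin> H \<longrightarrow> clique H E (boundary E H x))"

lemma sym_outside: "sym ((outside E H)\<^sup>*)"
  by (intro sym_rtrancl) (auto simp: sym_def outside_def insert_commute)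

lemma outside_rtrancl_notin: "(x, y) \<in> (outside E H)\<^sup>* \<Longrightarrow> x \<notin> H \<Longrightarrow> y \<notin> H"
  by (induction rule: rtrancl_induct) (auto simp: outside_def)

lemma boundary_eq: "(x, y) \<in> (outside E H)\<^sup>* \<Longrightarrow> boundary E H x = boundary E H y"
  unfolding boundary_def using sym_outside[of E H, THEN symD] by (blast intro: rtrancl_trans)

text \<open>Take \<open>v\<close> with the most neighbours in the boundary. If it misses \<open>s\<close>, the endpoint \<open>p n\<close> of a
  shortest path from \<open>v\<close> to a neighbour of \<open>s\<close> has more: if it missed a neighbour \<open>t\<close> of \<open>v\<close>, with
  \<open>p i\<close> the last vertex adjacent to \<open>t\<close>, then \<open>t, p i, \<dots>, p n, s\<close> would be a chordless cycle.\<close>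

lemma chordal_common_neighbour:
  assumes "chordal E" "finite H" "clique_bounded E H" "x \<notin> H"
  obtains v where "(x, v) \<in> (outside E H)\<^sup>*" "\<And>s. s \<in> boundary E H x \<Longrightarrow> {v, s} \<in> E"
proof -
  define N where "N v = {s \<in> boundary E H x. {v, s} \<in> E}" for v
  have fin: "finite (boundary E H x)"
    using assms(2) by (rule finite_subset[rotated]) (auto simp: boundary_def)
  \<comment> \<open>A uniform bound, so that the maximum of \<open>card (N y)\<close> over the
    component is attained.\<close>
  have "card (N y) < Suc (card (boundary E H x))" for y
    using fin by (auto simp: N_def less_Suc_eq_le intro: card_mono)
  then obtain v where v: "(x, v) \<in> (outside E H)\<^sup>*"
    and max: "\<And>y. (x, y) \<in> (outside E H)\<^sup>* \<Longrightarrow> card (N y) \<le> card (N v)"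
    using ex_has_greatest_nat[of "\<lambda>y. (x, y) \<in> (outside E H)\<^sup>*" x "\<lambda>y. card (N y)"] by blast
  have "{v, s} \<in> E" if s: "s \<in> boundary E H x" for s
  proof (rule ccontr)
    assume "{v, s} \<notin> E"
    \<comment> \<open>All vertices of a component share one boundary, so some path from
      \<open>v\<close> reaches a neighbour of \<open>s\<close>.\<close>
    have "s \<in> boundary E H v" using s boundary_eq[OF v] by simp
    then have "s \<in> H" and "\<exists>y. (v, y) \<in> (outside E H)\<^sup>* \<and> {y, s} \<in> E"
      by (auto simp: boundary_def)
    then obtain y where "(v, y) \<in> (outside E H)\<^sup>*" "{y, s} \<in> E" by blast
    then obtain p n where p: "p 0 = v" "{p n, s} \<in> E"
      "\<And>i. i < n \<Longrightarrow> (p i, p (Suc i)) \<in> outside E H" "inj_on p {..n}"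
      "\<And>i. i < n \<Longrightarrow> {p i, s} \<notin> E"
      "\<And>i j. Suc i < j \<Longrightarrow> j \<le> n \<Longrightarrow> (p i, p j) \<notin> outside E H"
      by (rule shortest_path[where P = "\<lambda>y. {y, s} \<in> E"]) auto
    have reach: "(x, p i) \<in> (outside E H)\<^sup>*" if "i \<le> n" for i
      using that by (induction i) (auto simp: p(1) v Suc_le_eq intro: rtrancl_into_rtrancl p(3))
    have notin: "p i \<notin> H" if "i \<le> n" for i
      using outside_rtrancl_notin[OF reach[OF that] assms(4)] .
    have no_chord: "{p i, p j} \<notin> E" if "Suc i < j" "j \<le> n" for i j
      using p(6)[OF that] notin that by (auto simp: outside_def)
    have "{p n, t} \<in> E" if t: "t \<in> N v" for t
    proof (rule ccontr)
      assume tn: "{p n, t} \<notin> E"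
      have tb: "t \<in> boundary E H x" "{t, v} \<in> E" "t \<in> H"
        using t by (auto simp: N_def boundary_def insert_commute)
      define J where "J = {j. j \<le> n \<and> {p j, t} \<in> E}"
      have "0 \<in> J" using tb(2) p(1) by (auto simp: J_def insert_commute)
      have "finite J" by (rule finite_subset[of _ "{..n}"]) (auto simp: J_def)
      define i where "i = Max J"
      have "i \<in> J" unfolding i_def using \<open>finite J\<close> \<open>0 \<in> J\<close> by (intro Max_in) auto
      have later: "{p j, t} \<notin> E" if "i < j" "j \<le> n" for j
        proof
        assume "{p j, t} \<in> E"
        then have "j \<in> J" using that by (simp add: J_def)
        then show False using Max_ge[OF \<open>finite J\<close>, of j] that by (simp add: i_def)
      qed
      have i: "i < n" "{p i, t} \<in> E"
        using \<open>i \<in> J\<close> tn by (auto simp: J_def order_le_less)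
      have "t \<noteq> s" using tb(2) \<open>{v, s} \<notin> E\<close> by (auto simp: insert_commute)
      have ts: "{s, t} \<in> E"
      proof -
        have "clique H E (boundary E H x)"
          using assms(3,4) by (simp add: clique_bounded_def)
        then show ?thesis using tb(1) s \<open>t \<noteq> s\<close> by (simp add: clique_def)
      qed
      define l where "l = n - i"
      have l: "1 \<le> l" "n = i + l" using i(1) by (auto simp: l_def)
      \<comment> \<open>The cycle has \<open>l + 3\<close> vertices: \<open>t\<close> at position 0,
        \<open>p i\<close> to \<open>p n\<close> at positions 1 to \<open>l + 1\<close> (hence the
        shift in \<open>g\<close>), and \<open>s\<close> at position \<open>l + 2\<close>. Since
        \<open>l\<close> is at least 1, it must have a chord.\<close>
      define g where "g k = p (i + (k - 1))" for k
      define c where "c k = (if k = 0 then t else if k = l + 2 then s else g k)" for k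
      define xs where "xs = map c [0..<l + 3]"
      have len: "length xs = l + 3" by (simp add: xs_def)
      have nth: "xs ! k = c k" if "k < l + 3" for k using that by (simp add: xs_def)
      have "inj_on c {0..<l + 3}"
      proof (rule linorder_inj_onI)
        fix a b assume ab: "a < b" "a \<in> {0..<l + 3}" "b \<in> {0..<l + 3}"
        have "g a \<noteq> g b" if "a \<noteq> 0" "b \<noteq> l + 2"
        proof -
          have "i + (a - 1) < i + (b - 1)" "i + (b - 1) \<le> n" using ab l that by auto
          then show ?thesis using inj_on_eq_iff[OF p(4), of "i + (a - 1)" "i + (b - 1)"] by (simp add: g_def)
        qed
        moreover have "g k \<notin> {s, t}" if "k \<noteq> l + 2" "k < l + 3" for k
        proof -
          have "i + (k - 1) \<le> n" using that l by linarith
          then show ?thesis using notin \<open>s \<in> H\<close> \<open>t \<in> H\<close> by (auto simp: g_def)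
        qed
        ultimately show "c a \<noteq> c b" using ab \<open>t \<noteq> s\<close> by (auto simp: c_def)
      qed auto
      then have "distinct xs" by (simp add: xs_def distinct_map)
      have nxt: "Suc k mod (l + 3) = (if k = l + 2 then 0 else Suc k)" if "k < l + 3" for k
      proof (cases "k = l + 2")
        case True
        then have "Suc k = l + 3" by simp
        then show ?thesis using True by (metis mod_self)
      qed (use that in simp)
      have "{c k, c (Suc k mod (l + 3))} \<in> E" if k: "k < l + 3" for k
      proof -
        consider "k = 0" | "k = l + 2" | "k = l + 1" | "0 < k" "k < l + 1" using k by linarith
        then show ?thesis
        proof cases
          case 1 then show ?thesis using i(2) l by (simp add: nxt c_def g_def insert_commute)
        next
          case 2 then show ?thesis using ts by (simp add: nxt c_def g_def)
        next
          case 3 then show ?thesis using p(2) l by (simp add: nxt c_def g_def)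
        next
          case 4
          then have "(p (i + (k - 1)), p (Suc (i + (k - 1)))) \<in> outside E H"
            using l by (intro p(3)) auto
          then show ?thesis using 4 by (simp add: nxt c_def g_def outside_def)
        qed
      qed
      with \<open>distinct xs\<close> have "graph_cycle E xs"
        by (simp add: graph_cycle_def len nth)
      moreover have "length xs > 3" using len l by simp
      ultimately have "has_chord E xs" using assms(1) by (simp add: chordal_def)
      then obtain a b where ab: "a < l + 3" "b < l + 3" "a \<noteq> b" "Suc a mod (l + 3) \<noteq> b"
        "Suc b mod (l + 3) \<noteq> a" "{c a, c b} \<in> E"
        by (auto simp: has_chord_def len nth)
      \<comment> \<open>Every chord is excluded: \<open>t\<close> and \<open>s\<close> are
        cyclically consecutive, \<open>i\<close> is the last index adjacent to \<open>t\<close>,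
        only \<open>p n\<close> is adjacent to \<open>s\<close>, and a shortest path has no
        shortcut.\<close>
      have False if ab: "a < b" "b < l + 3" "Suc a \<noteq> b" "Suc b mod (l + 3) \<noteq> a" "{c a, c b} \<in> E"
        for a b
      proof -
        consider "a = 0" "b = l + 2" | "a = 0" "b \<noteq> l + 2" | "a \<noteq> 0" "b = l + 2"
          | "a \<noteq> 0" "b \<noteq> l + 2" by blast
        then show False
        proof cases
          case 1 then show False using ab nxt[of b] by simp
        next
          case 2
          then have "i < i + (b - 1)" "i + (b - 1) \<le> n" using ab l by linarith+
          from later[OF this] show False using ab 2 by (simp add: c_def g_def insert_commute)
        next
          case 3
          then have "i + (a - 1) < n" using ab l nxt[of b] by simp
          from p(5)[OF this] show False using ab 3 by (simp add: c_def g_def)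
        next
          case 4
          then have "Suc (i + (a - 1)) < i + (b - 1)" "i + (b - 1) \<le> n" using ab l by linarith+
          from no_chord[OF this] show False using ab 4 by (simp add: c_def g_def)
        qed
      qed
      from this[of a b] this[of b a] show False
        using ab by (cases a b rule: linorder_cases) (auto simp: insert_commute nxt split: if_splits)
    qed
    then have "N v \<subseteq> N (p n)" by (auto simp: N_def)
    moreover have "s \<in> N (p n)" "s \<notin> N v" using s p(2) \<open>{v, s} \<notin> E\<close> by (auto simp: N_def)
    ultimately have "card (N v) < card (N (p n))"
      using fin by (intro psubset_card_mono) (auto simp: N_def)
    then show False using max[OF reach[of n]] by simp
  qed
  with v show ?thesis by (rule that)
qed

text \<open>Components only shrink when \<open>v\<close> moves into \<open>H\<close>, so boundary
  vertices other than \<open>v\<close> were in the boundary before. If \<open>v\<close> itself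
  bounds the component of \<open>x\<close>, then \<open>x\<close> was in the old component of
  \<open>v\<close>, whose boundary is adjacent to \<open>v\<close>.\<close>

lemma clique_bounded_insert:
  assumes "clique_bounded E H" "v \<notin> H" "\<And>s. s \<in> boundary E H v \<Longrightarrow> {v, s} \<in> E"
  shows "clique_bounded E (insert v H)"
proof -
  have "{s, t} \<in> E"
    if x: "x \<notin> insert v H" and st: "s \<noteq> t"
      and s: "s \<in> boundary E (insert v H) x" and t: "t \<in> boundary E (insert v H) x" for x s t
  proof -
    have mono: "(outside E (insert v H))\<^sup>* \<subseteq> (outside E H)\<^sup>*"
      by (intro rtrancl_mono) (auto simp: outside_def)
    have old: "r \<in> boundary E H x" if "r \<in> boundary E (insert v H) x" "r \<noteq> v" for r
      using that mono by (auto simp: boundary_def)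
    have new: "{v, r} \<in> E"
      if v: "v \<in> boundary E (insert v H) x" and r: "r \<in> boundary E (insert v H) x" "r \<noteq> v" for r
    proof -
      obtain y where y: "(x, y) \<in> (outside E H)\<^sup>*" "{y, v} \<in> E"
        using v mono by (auto simp: boundary_def)
      moreover have "y \<notin> H" using outside_rtrancl_notin[OF y(1)] x by simp
      ultimately have "(x, v) \<in> (outside E H)\<^sup>*"
        using \<open>v \<notin> H\<close> by (auto simp: outside_def intro: rtrancl_into_rtrancl)
      then show ?thesis using assms(3) old[OF r] boundary_eq by metis
    qed
    show ?thesis
    proof (cases "s = v \<or> t = v")
      case True
      then show ?thesis using new s t st by (auto simp: insert_commute)
    next
      case False
      then show ?thesis
        using assms(1) old s t x st unfolding clique_bounded_def clique_def by blast
    qed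
  qed
  then show ?thesis by (auto simp: clique_bounded_def clique_def boundary_def)
qed

subsection \<open>Marginal sums\<close>

text \<open>A marginal frequency whose position is given by an arbitrary function, of which only the
  values on \<open>D\<close> matter; margins over different sets can thus be compared at the same
  \<open>i\<close> without restricting it.\<close>

definition agree_sum :: "cell set \<Rightarrow> nat set \<Rightarrow> table \<Rightarrow> cell \<Rightarrow> int" where
  "agree_sum \<Omega> D z i = sum z {k \<in> \<Omega>. \<forall>d\<in>D. k d = i d}"

lemma agree_sum_cong: "(\<And>d. d \<in> D \<Longrightarrow> i d = j d) \<Longrightarrow> agree_sum \<Omega> D z i = agree_sum \<Omega> D z j"
  by (simp add: agree_sum_def)

lemma agree_sum_add: "agree_sum \<Omega> D (x + y) i = agree_sum \<Omega> D x i + agree_sum \<Omega> D y i"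
  by (simp add: agree_sum_def sum.distrib)

lemma agree_sum_diff: "agree_sum \<Omega> D (x - y) i = agree_sum \<Omega> D x i - agree_sum \<Omega> D y i"
  by (simp add: agree_sum_def sum_subtractf)

definition unit_table :: "cell \<Rightarrow> table" where
  "unit_table i = (\<lambda>k. if k = i then 1 else 0)"

lemma agree_sum_unit_table:
  assumes "finite \<Omega>" "i \<in> \<Omega>"
  shows "agree_sum \<Omega> D (unit_table i) j = (if \<forall>d\<in>D. i d = j d then 1 else 0)"
  using assms by (simp add: agree_sum_def unit_table_def)

lemma agree_sum_unit_table_cong:
  assumes "finite \<Omega>" "i \<in> \<Omega>" "i' \<in> \<Omega>" "\<And>d. d \<in> D \<Longrightarrow> i d = i' d"
  shows "agree_sum \<Omega> D (unit_table i) = agree_sum \<Omega> D (unit_table i')"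
  using assms by (intro ext) (simp add: agree_sum_unit_table)

lemma agree_sum_pos_cell:
  assumes "0 < agree_sum \<Omega> D z i"
  obtains k where "k \<in> \<Omega>" "\<And>d. d \<in> D \<Longrightarrow> k d = i d" "0 < z k"
proof -
  have "\<not> (\<forall>k\<in>{k \<in> \<Omega>. \<forall>d\<in>D. k d = i d}. z k \<le> 0)"
    using assms sum_nonpos[of "{k \<in> \<Omega>. \<forall>d\<in>D. k d = i d}" z] by (auto simp: agree_sum_def)
  then show ?thesis using that by force
qed

text \<open>The cells agreeing with \<open>i\<close> on \<open>S\<close> are grouped by their
  restriction to \<open>D\<close>; each group contributes one \<open>D\<close>-margin.\<close>

lemma agree_sum_coarsen:
  assumes "finite \<Omega>" "S \<subseteq> D"
  shows "agree_sum \<Omega> S z i =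
    sum (agree_sum \<Omega> D z) ((\<lambda>k. restrict k D) ` {k \<in> \<Omega>. \<forall>d\<in>S. k d = i d})"
proof -
  let ?A = "{k \<in> \<Omega>. \<forall>d\<in>S. k d = i d}"
  have "agree_sum \<Omega> S z i =
    (\<Sum>j\<in>(\<lambda>k. restrict k D) ` ?A. sum z {k \<in> ?A. restrict k D = j})"
    unfolding agree_sum_def using assms(1) by (intro sum.image_gen) auto
  also have "\<dots> = sum (agree_sum \<Omega> D z) ((\<lambda>k. restrict k D) ` ?A)"
    unfolding agree_sum_def
  proof (intro sum.cong refl)
    fix j assume "j \<in> (\<lambda>k. restrict k D) ` ?A"
    then obtain l where l: "l \<in> ?A" "j = restrict l D" by blast
    have "k \<in> ?A \<and> restrict k D = j \<longleftrightarrow> k \<in> \<Omega> \<and> (\<forall>d\<in>D. k d = j d)" for k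
      using l assms(2) by (auto simp: restrict_def fun_eq_iff)
    then show "{k \<in> ?A. restrict k D = j} = {k \<in> \<Omega>. \<forall>d\<in>D. k d = j d}" by blast
  qed
  finally show ?thesis .
qed

text \<open>The \<open>D\<close>-margins above a fixed position on \<open>S\<close> add up to the
  \<open>S\<close>-margin, here zero, so a positive one is balanced by a negative one.\<close>

lemma agree_sum_compensate:
  assumes "finite \<Omega>" "S \<subseteq> D" "agree_sum \<Omega> S z i = 0" "0 < agree_sum \<Omega> D z i"
  obtains k where "\<And>d. d \<in> S \<Longrightarrow> k d = i d" "agree_sum \<Omega> D z k < 0"
proof -
  let ?A = "(\<lambda>k. restrict k D) ` {k \<in> \<Omega>. \<forall>d\<in>S. k d = i d}"
  obtain l where l: "l \<in> \<Omega>" "\<And>d. d \<in> D \<Longrightarrow> l d = i d"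
    using agree_sum_pos_cell[OF assms(4)] by metis
  have "restrict l D \<in> ?A" using l assms(2) by auto
  moreover have "0 < agree_sum \<Omega> D z (restrict l D)"
    using assms(4) l by (simp add: agree_sum_def)
  moreover have "sum (agree_sum \<Omega> D z) ?A = 0"
    using assms(3) agree_sum_coarsen[OF assms(1,2)] by simp
  ultimately have "\<not> (\<forall>j\<in>?A. 0 \<le> agree_sum \<Omega> D z j)"
    using sum_nonneg_eq_0_iff[of ?A "agree_sum \<Omega> D z"] assms(1) by fastforce
  then obtain k where "k \<in> \<Omega>" "\<forall>d\<in>S. k d = i d" "agree_sum \<Omega> D z (restrict k D) < 0"
    by (auto simp: not_le)
  moreover have "agree_sum \<Omega> D z (restrict k D) = agree_sum \<Omega> D z k"
    by (simp add: agree_sum_def)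
  ultimately show ?thesis using that by auto
qed

lemma agree_sum_zero_mono:
  assumes "finite \<Omega>" "S \<subseteq> D" "\<And>j. agree_sum \<Omega> D z j = 0"
  shows "agree_sum \<Omega> S z i = 0"
  using assms by (simp add: agree_sum_coarsen[OF assms(1,2)])

section \<open>The margins of the model as sums over agreeing cells\<close>

lemma marginal_eq_agree_sum:
  assumes "D \<subseteq> {1..m}" "j \<in> cells I D"
  shows "marginal m I D n j = agree_sum (cells I {1..m}) D n j"
proof -
  let ?g = "\<lambda>k d. if d \<in> D then j d else k d"
  have "bij_betw ?g (cells I ({1..m} - D)) {k \<in> cells I {1..m}. \<forall>d\<in>D. k d = j d}"
  proof (rule bij_betw_byWitness[where f' = "\<lambda>k. restrict k ({1..m} - D)"])
    show "\<forall>a\<in>cells I ({1..m} - D). restrict (?g a) ({1..m} - D) = a"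
      by (auto simp: cells_def PiE_def extensional_def fun_eq_iff restrict_def)
    show "\<forall>k\<in>{k \<in> cells I {1..m}. \<forall>d\<in>D. k d = j d}. ?g (restrict k ({1..m} - D)) = k"
      by (auto simp: cells_def PiE_def extensional_def fun_eq_iff restrict_def)
    show "?g ` cells I ({1..m} - D) \<subseteq> {k \<in> cells I {1..m}. \<forall>d\<in>D. k d = j d}"
      using assms by (auto simp: cells_def PiE_def Pi_def extensional_def)
    show "(\<lambda>k. restrict k ({1..m} - D)) ` {k \<in> cells I {1..m}. \<forall>d\<in>D. k d = j d}
        \<subseteq> cells I ({1..m} - D)"
      by (auto simp: cells_def PiE_def Pi_def extensional_def)
  qed
  from sum.reindex_bij_betw[OF this, of n] show ?thesis
    by (simp add: marginal_def agree_sum_def)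
qed

lemma margins_eq_iff:
  assumes "\<Union>\<D> = {1..m}"
  shows "margins m I \<D> n = margins m I \<D> n' \<longleftrightarrow>
    (\<forall>D\<in>\<D>. \<forall>j. agree_sum (cells I {1..m}) D n j = agree_sum (cells I {1..m}) D n' j)"
    (is "?L \<longleftrightarrow> ?R")
proof
  have marg: "margins m I \<D> n D j = agree_sum (cells I {1..m}) D n j"
    if "D \<in> \<D>" "j \<in> cells I D" for n D j
    using marginal_eq_agree_sum[of D m j I n] that assms by (auto simp: margins_def)
  assume L: ?L
  show ?R
  proof (intro ballI allI)
    fix D j assume D: "D \<in> \<D>"
    show "agree_sum (cells I {1..m}) D n j = agree_sum (cells I {1..m}) D n' j"
    proof (cases "restrict j D \<in> cells I D")
      case True
      have "agree_sum (cells I {1..m}) D n (restrict j D) = agree_sum (cells I {1..m}) D n' (restrict j D)"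
        using marg[OF D True] L by metis
      then show ?thesis by (simp add: agree_sum_def)
    next
      case False
      \<comment> \<open>A position with a level out of range agrees with no cell, so both sums are
        empty.\<close>
      have "{k \<in> cells I {1..m}. \<forall>d\<in>D. k d = j d} = {}"
      proof (rule ccontr)
        assume "{k \<in> cells I {1..m}. \<forall>d\<in>D. k d = j d} \<noteq> {}"
        then obtain k where k: "k \<in> cells I {1..m}" "\<forall>d\<in>D. k d = j d" by blast
        have "D \<subseteq> {1..m}" using D assms by blast
        then have "restrict k D \<in> cells I D"
          using k(1) by (auto simp: cells_def PiE_def Pi_def)
        moreover have "restrict k D = restrict j D" using k(2) by (intro restrict_ext) simp
        ultimately show False using False by simp
      qed
      then show ?thesis by (simp only: agree_sum_def sum.empty)
    qed
  qed
next
  assume ?R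
  moreover have "D \<subseteq> {1..m}" if "D \<in> \<D>" for D using that assms by auto
  ultimately show ?L by (auto simp: margins_def marginal_eq_agree_sum fun_eq_iff)
qed

lemma margins_zero: "margins m I \<D> 0 D j = 0"
  by (simp add: margins_def marginal_def)

lemma up_to_sign_eq_iff: "up_to_sign x = up_to_sign y \<longleftrightarrow> x = y \<or> x = - y"
  unfolding up_to_sign_def by (auto simp: doubleton_eq_iff)

lemma up_to_sign_doubleton: "{x, y} = {u, w} \<Longrightarrow> up_to_sign (x - y) = up_to_sign (u - w)"
  by (auto simp: up_to_sign_eq_iff doubleton_eq_iff)

subsection \<open>Exchange moves of degree two\<close>

locale decomposable_model =
  fixes m :: nat and I :: "nat \<Rightarrow> nat" and \<D> :: "nat set set"
  assumes generating: "generating_class {1..m} \<D>" and decomp: "decomposable {1..m} \<D>"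
begin

definition \<Omega> :: "cell set" where
  "\<Omega> = cells I {1..m}"

lemma finite_\<Omega>: "finite \<Omega>"
  by (simp add: \<Omega>_def finite_cells)

lemma Union_\<D>: "\<Union>\<D> = {1..m}"
  using generating by (simp add: generating_class_def)

lemma chordal: "chordal (independence_graph \<D>)"
  using decomp by (simp add: decomposable_def)

text \<open>A largest clique containing \<open>C\<close> is a maximal clique, hence by
  decomposability a member of the generating class.\<close>

lemma clique_subset_facet:
  assumes "clique {1..m} (independence_graph \<D>) C"
  obtains D where "D \<in> \<D>" "C \<subseteq> D"
proof -
  let ?P = "\<lambda>K. clique {1..m} (independence_graph \<D>) K \<and> C \<subseteq> K"
  have "card K < Suc m" if "?P K" for K
    using card_mono[of "{1..m}" K] that by (auto simp: clique_def)
  then obtain K where K: "?P K" and max: "\<And>K'. ?P K' \<Longrightarrow> card K' \<le> card K"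
    using ex_has_greatest_nat[of ?P C card "Suc m"] assms by blast
  have "\<not> K \<subset> C'" if C': "clique {1..m} (independence_graph \<D>) C'" for C'
  proof
    assume "K \<subset> C'"
    moreover from this have "card K < card C'"
      using C' by (intro psubset_card_mono) (auto simp: clique_def intro: finite_subset)
    ultimately show False using max[of C'] C' K by auto
  qed
  then have "K \<in> maximal_cliques {1..m} (independence_graph \<D>)"
    using K by (auto simp: maximal_cliques_def)
  then show ?thesis using that K decomp by (auto simp: decomposable_def)
qed

lemma facet_edge: "D \<in> \<D> \<Longrightarrow> x \<in> D \<Longrightarrow> y \<in> D \<Longrightarrow> x \<noteq> y \<Longrightarrow> {x, y} \<in> independence_graph \<D>"
  by (auto simp: independence_graph_def)

abbreviation same_margins :: "table \<Rightarrow> table \<Rightarrow> bool" where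
  "same_margins n n' \<equiv> (\<forall>D\<in>\<D>. \<forall>j. agree_sum \<Omega> D n j = agree_sum \<Omega> D n' j)"

text \<open>A move of degree two from \<open>p\<close> to \<open>p'\<close> on top of an unchanged
  remainder \<open>q\<close>. Keeping \<open>q\<close> explicit allows the step to be replaced later
  by a path inside the fiber of \<open>p\<close>.\<close>

definition exchange :: "(table \<times> table) set" where
  "exchange = {(q + p, q + p') | q p p'. q \<in> tables m I \<and> p \<in> tables m I \<and> p' \<in> tables m I \<and>
     sample_size m I p = 2 \<and> margins m I \<D> p = margins m I \<D> p'}"

lemma margins_eq: "margins m I \<D> n = margins m I \<D> n' \<longleftrightarrow> same_margins n n'"
  unfolding \<Omega>_def by (rule margins_eq_iff[OF Union_\<D>])

lemma unit_table_in_tables: "i \<in> \<Omega> \<Longrightarrow> unit_table i \<in> tables m I"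
  by (auto simp: \<Omega>_def tables_def arrays_def unit_table_def)

lemma add_in_tables: "x \<in> tables m I \<Longrightarrow> y \<in> tables m I \<Longrightarrow> x + y \<in> tables m I"
  by (auto simp: tables_def arrays_def)

lemma sample_size_eq_agree_sum: "sample_size m I n = agree_sum \<Omega> {} n i"
  by (simp add: \<Omega>_def sample_size_def agree_sum_def)

text \<open>The two cells are chosen so that the swap lowers two margins that are too large and
  raises one that is too small; the fourth affected margin can cost at most one of these three
  gains.\<close>

lemma exchange_step:
  assumes n: "n \<in> tables m I" "n' \<in> tables m I" "same_margins n n'"
    and H: "H \<subseteq> {1..m}" "\<And>j. agree_sum \<Omega> H n j = agree_sum \<Omega> H n' j"
    and v: "v \<in> {1..m}" "v \<notin> H"
      "\<And>s. s \<in> boundary (independence_graph \<D>) H v \<Longrightarrow> {v, s} \<in> independence_graph \<D>"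
      "clique_bounded (independence_graph \<D>) H"
    and ne: "agree_sum \<Omega> (insert v H) n j0 \<noteq> agree_sum \<Omega> (insert v H) n' j0"
  obtains n'' where "(n, n'') \<in> exchange" "\<And>j. agree_sum \<Omega> H n'' j = agree_sum \<Omega> H n j"
    "(\<Sum>j\<in>cells I (insert v H). \<bar>agree_sum \<Omega> (insert v H) (n'' - n') j\<bar>) <
     (\<Sum>j\<in>cells I (insert v H). \<bar>agree_sum \<Omega> (insert v H) (n - n') j\<bar>)"
proof -
  define E where "E = independence_graph \<D>"
  define C where "C = (outside E H)\<^sup>* `` {v}"
  define S where "S = boundary E H v"
  define K where "K = insert v H"
  define f where "f = agree_sum \<Omega> K (n - n')"
  have zH: "agree_sum \<Omega> H (n - n') j = 0" "agree_sum \<Omega> H (n' - n) j = 0" for j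
    using H(2) by (simp_all add: agree_sum_diff)
  have SH: "S \<subseteq> H" by (auto simp: S_def boundary_def)
  have vC: "v \<in> C" by (simp add: C_def)
  have CH: "C \<inter> H = {}" using outside_rtrancl_notin v(2) by (fastforce simp: C_def)
  have fn: "f j = agree_sum \<Omega> K n j - agree_sum \<Omega> K n' j" for j
    by (simp add: f_def agree_sum_diff)
  have swap: "- f j = agree_sum \<Omega> K (n' - n) j" for j
    by (simp add: fn agree_sum_diff)
  have f_cong: "f i = f j" if "\<And>d. d \<in> K \<Longrightarrow> i d = j d" for i j
    unfolding f_def using that by (rule agree_sum_cong)
  have "clique {1..m} E (insert v S)"
  proof -
    have "clique H E S" using v(2,4) by (simp add: clique_bounded_def S_def E_def)
    moreover have "{v, s} \<in> E" if "s \<in> S" for s using v(3) that by (simp add: S_def E_def)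
    ultimately show ?thesis using v(1) H(1) by (auto simp: clique_def insert_commute)
  qed
  then obtain D0 where D0: "D0 \<in> \<D>" "insert v S \<subseteq> D0"
    unfolding E_def by (rule clique_subset_facet)
  \<comment> \<open>The clique \<open>insert v S\<close> lies in a facet, so the two tables share
    its margin as well.\<close>
  have zS: "agree_sum \<Omega> (insert v S) (n' - n) j = 0" for j
    by (rule agree_sum_zero_mono[OF finite_\<Omega> D0(2)]) (use n(3) D0(1) in \<open>simp add: agree_sum_diff\<close>)
  \<comment> \<open>If the known discrepancy is negative, equality of the \<open>H\<close>-margins
    forces a positive one elsewhere.\<close>
  obtain i0 where i0: "0 < f i0"
  proof (cases "0 < f j0")
    case False
    moreover have "f j0 \<noteq> 0" using ne by (simp add: fn K_def)
    ultimately have "0 < agree_sum \<Omega> K (n' - n) j0" using swap[of j0] by linarith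
    then obtain k where "agree_sum \<Omega> K (n' - n) k < 0"
      using agree_sum_compensate[OF finite_\<Omega> _ zH(2)] unfolding K_def by blast
    then show ?thesis using that[of k] swap[of k] by linarith
  qed
  obtain i1 where i1: "\<And>d. d \<in> H \<Longrightarrow> i1 d = i0 d" "f i1 < 0"
    using agree_sum_compensate[OF finite_\<Omega> _ zH(1), of K i0] i0 unfolding K_def f_def by blast
  have "0 < agree_sum \<Omega> K (n' - n) i1" using i1(2) swap[of i1] by linarith
  \<comment> \<open>The deficit at \<open>i1\<close> is balanced by an excess that agrees with it on
    \<open>insert v S\<close>. So \<open>i0\<close> and \<open>i2\<close> are excesses agreeing on
    \<open>S\<close>, and \<open>i1\<close> joins the \<open>H\<close>-part of \<open>i0\<close> to
    the \<open>v\<close>-level of \<open>i2\<close>.\<close>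
  then obtain i2 where i2: "\<And>d. d \<in> insert v S \<Longrightarrow> i2 d = i1 d" "0 < f i2"
    using agree_sum_compensate[OF finite_\<Omega> _ zS, of K i1] SH swap
    unfolding K_def by (metis insert_mono neg_less_0_iff_less)
  have n'_nonneg: "0 \<le> agree_sum \<Omega> K n' j" for j
    using n(2) by (auto simp: agree_sum_def tables_def intro: sum_nonneg)
  have n_pos: "0 < agree_sum \<Omega> K n j" if "0 < f j" for j
    using that fn[of j] n'_nonneg[of j] by linarith
  \<comment> \<open>An excess over the nonnegative margin of \<open>n'\<close> means that
    \<open>n\<close> itself has a positive entry there.\<close>
  obtain i where i: "i \<in> \<Omega>" "\<And>d. d \<in> K \<Longrightarrow> i d = i0 d" "0 < n i"
    using agree_sum_pos_cell[OF n_pos[OF i0]] by blast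
  obtain j where j: "j \<in> \<Omega>" "\<And>d. d \<in> K \<Longrightarrow> j d = i2 d" "0 < n j"
    using agree_sum_pos_cell[OF n_pos[OF i2(2)]] by blast
  define i' where "i' = (\<lambda>d. if d \<in> C then j d else i d)"
  define j' where "j' = (\<lambda>d. if d \<in> C then i d else j d)"
  have cells': "i' \<in> \<Omega>" "j' \<in> \<Omega>"
    using i(1) j(1) by (auto simp: i'_def j'_def \<Omega>_def cells_def PiE_def Pi_def extensional_def)
  have fi: "0 < f i" "0 < f j" using i0 i2(2) f_cong[OF i(2)] f_cong[OF j(2)] by simp_all
  \<comment> \<open>\<open>C\<close> meets \<open>K\<close> only in \<open>v\<close>, so on
    \<open>K\<close> the new cell follows \<open>i0\<close> on \<open>H\<close> and
    \<open>i2\<close> at \<open>v\<close>, which is \<open>i1\<close>.\<close>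
  have i'_K: "i' d = i1 d" if "d \<in> K" for d
    using that i(2)[of d] j(2)[of d] i1(1)[of d] i2(1)[of d] CH vC
    by (auto simp: i'_def K_def)
  then have fi': "f i' < 0" using f_cong[of i' i1] i1(2) by simp
  \<comment> \<open>Makes \<open>i\<close> and \<open>j\<close> distinct cells, so that subtracting
    both from \<open>n\<close> leaves no negative entry, and keeps their \<open>K\<close>-margins
    apart.\<close>
  have ij_v: "i v \<noteq> j v"
  proof
    assume "i v = j v"
    then have "i' d = i d" if "d \<in> K" for d
      using that CH by (auto simp: i'_def K_def)
    then show False using f_cong[of i' i] fi fi' by simp
  qed
  then have ij: "i \<noteq> j" by auto
  have ij_S: "i d = j d" if "d \<in> S" for d
    using that SH i(2)[of d] j(2)[of d] i1(1)[of d] i2(1)[of d] by (auto simp: K_def)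
  \<comment> \<open>Vertices of a facet are pairwise adjacent, so a facet meeting \<open>C\<close>
    consists of vertices of \<open>C\<close> and neighbours of \<open>C\<close>. On such a facet the
    swap merely interchanges \<open>i\<close> and \<open>j\<close>; on the others it changes
    nothing.\<close>
  have facet: "D \<subseteq> C \<union> S \<or> D \<inter> C = {}" if D: "D \<in> \<D>" for D
  proof (rule disjCI)
    assume "D \<inter> C \<noteq> {}"
    then obtain c where c: "c \<in> D" "(v, c) \<in> (outside E H)\<^sup>*" by (auto simp: C_def)
    have "c \<notin> H" using outside_rtrancl_notin[OF c(2) v(2)] .
    have "d \<in> C \<union> S" if d: "d \<in> D" for d
    proof (cases "d = c")
      case False
      then have "{c, d} \<in> E" using facet_edge[OF D c(1) d] by (auto simp: E_def)
      then show ?thesis using c(2) \<open>c \<notin> H\<close>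
        by (cases "d \<in> H") (auto simp: C_def S_def boundary_def outside_def intro: rtrancl_into_rtrancl)
    qed (use c in \<open>simp add: C_def\<close>)
    then show "D \<subseteq> C \<union> S" by blast
  qed
  define p where "p = unit_table i + unit_table j"
  define p' where "p' = unit_table i' + unit_table j'"
  define q where "q = n - p"
  have "agree_sum \<Omega> D p k = agree_sum \<Omega> D p' k" if "D \<in> \<D>" for D k
  proof -
    note cong = agree_sum_unit_table_cong[OF finite_\<Omega>]
    from facet[OF that] show ?thesis
    proof
      assume "D \<subseteq> C \<union> S"
      then have "i' d = j d" "j' d = i d" if "d \<in> D" for d
        using that ij_S by (auto simp: i'_def j'_def)
      then show ?thesis
        using cong[OF cells'(1) j(1), of D] cong[OF cells'(2) i(1), of D]
        by (simp add: p_def p'_def agree_sum_add)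
    next
      assume "D \<inter> C = {}"
      then have "i' d = i d" "j' d = j d" if "d \<in> D" for d
        using that by (auto simp: i'_def j'_def)
      then show ?thesis
        using cong[OF cells'(1) i(1), of D] cong[OF cells'(2) j(1), of D]
        by (simp add: p_def p'_def agree_sum_add)
    qed
  qed
  then have "margins m I \<D> p = margins m I \<D> p'" by (simp add: margins_eq)
  moreover have "q \<in> tables m I"
    using n(1) i j ij by (auto simp: \<Omega>_def q_def p_def tables_def arrays_def unit_table_def)
  moreover have "p \<in> tables m I" "p' \<in> tables m I"
    using i(1) j(1) cells' by (auto simp: p_def p'_def intro: add_in_tables unit_table_in_tables)
  moreover have "sample_size m I p = 2"
    using i(1) j(1) by (simp add: sample_size_eq_agree_sum[of _ undefined] p_def agree_sum_add agree_sum_unit_table finite_\<Omega>)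
  moreover have "n = q + p" by (simp add: q_def)
  ultimately have "(n, q + p') \<in> exchange" unfolding exchange_def by blast
  moreover have "agree_sum \<Omega> H (q + p') k = agree_sum \<Omega> H n k" for k
  proof -
    have "i' d = i d" "j' d = j d" if "d \<in> H" for d
      using that CH by (auto simp: i'_def j'_def)
    then show ?thesis
      using agree_sum_unit_table_cong[OF finite_\<Omega> cells'(1) i(1), of H]
        agree_sum_unit_table_cong[OF finite_\<Omega> cells'(2) j(1), of H]
      by (simp add: q_def p_def p'_def agree_sum_add agree_sum_diff)
  qed
  moreover have "(\<Sum>k\<in>cells I K. \<bar>agree_sum \<Omega> K (q + p' - n') k\<bar>) < (\<Sum>k\<in>cells I K. \<bar>f k\<bar>)"
  proof -
    define \<delta> :: "cell \<Rightarrow> cell \<Rightarrow> int" where "\<delta> i k = (if k = restrict i K then 1 else 0)" for i k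
    have K: "K \<subseteq> {1..m}" "finite K" using H(1) v(1) by (auto simp: K_def intro: finite_subset)
    have restr: "restrict k K \<in> cells I K" if "k \<in> \<Omega>" for k
      using that K(1) by (auto simp: \<Omega>_def cells_def PiE_def Pi_def)
    have unit: "agree_sum \<Omega> K (unit_table l) k = \<delta> l k" if "l \<in> \<Omega>" "k \<in> cells I K" for l k
    proof -
      have "k \<in> extensional K" using that(2) by (simp add: cells_def PiE_def)
      then have "k = restrict l K \<longleftrightarrow> (\<forall>d\<in>K. l d = k d)"
        by (auto simp: extensional_def fun_eq_iff)
      then show ?thesis using that(1) by (simp add: \<delta>_def agree_sum_unit_table finite_\<Omega>)
    qed
    have new: "agree_sum \<Omega> K (q + p' - n') k = f k - \<delta> i k - \<delta> j k + \<delta> i' k + \<delta> j' k"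
      if "k \<in> cells I K" for k
      using that i(1) j(1) cells'
      by (simp add: q_def p_def p'_def agree_sum_add agree_sum_diff unit fn)
    have f_restr: "f (restrict l K) = f l" for l by (rule f_cong) simp
    have "restrict i K \<noteq> restrict j K" using ij_v by (metis K_def insertI1 restrict_apply')
    moreover have "restrict i K \<noteq> restrict i' K" "restrict j K \<noteq> restrict i' K"
      using fi fi' f_restr by (metis less_asym)+
    \<comment> \<open>Removing \<open>i\<close> and \<open>j\<close> and adding \<open>i'\<close>
      each gain one; nothing is known about the position of \<open>j'\<close>, which costs at most
      one. The total falls by at least two.\<close>
    ultimately have "\<bar>f k - \<delta> i k - \<delta> j k + \<delta> i' k + \<delta> j' k\<bar> \<le> \<bar>f k\<bar> + (\<delta> j' k - \<delta> i k - \<delta> j k - \<delta> i' k)" for k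
      using fi fi' f_restr[of i] f_restr[of j] f_restr[of i'] by (auto simp: \<delta>_def)
    then have "(\<Sum>k\<in>cells I K. \<bar>agree_sum \<Omega> K (q + p' - n') k\<bar>)
        \<le> (\<Sum>k\<in>cells I K. \<bar>f k\<bar> + (\<delta> j' k - \<delta> i k - \<delta> j k - \<delta> i' k))"
      by (intro sum_mono) (simp add: new)
    also have "\<dots> = (\<Sum>k\<in>cells I K. \<bar>f k\<bar>) - 2"
      using restr[OF i(1)] restr[OF j(1)] restr[OF cells'(1)] restr[OF cells'(2)] finite_cells[OF K(2)]
      by (simp add: sum.distrib sum_subtractf \<delta>_def)
    finally show ?thesis by simp
  qed
  ultimately show ?thesis using that by (simp add: K_def f_def)
qed

section \<open>Connecting every fiber by exchanges\<close>

lemma exchange_preserves: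
  assumes "(n, n'') \<in> exchange"
  shows "n'' \<in> tables m I" "same_margins n n''"
proof -
  obtain q p p' where *: "n = q + p" "n'' = q + p'" "q \<in> tables m I" "p' \<in> tables m I"
    "same_margins p p'"
    using assms unfolding exchange_def margins_eq by blast
  then show "n'' \<in> tables m I" by (simp add: add_in_tables)
  show "same_margins n n''" using * by (simp add: agree_sum_add)
qed

text \<open>Descent on the distance of the \<open>insert v H\<close>-margins; it can be repeated
  because exchanges keep all facet margins and the chosen ones also keep the
  \<open>H\<close>-margins.\<close>

lemma exchange_extend:
  assumes n: "n \<in> tables m I" "n' \<in> tables m I" "same_margins n n'"
    and H: "H \<subseteq> {1..m}" "\<And>j. agree_sum \<Omega> H n j = agree_sum \<Omega> H n' j"
    and v: "v \<in> {1..m}" "v \<notin> H"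
      "\<And>s. s \<in> boundary (independence_graph \<D>) H v \<Longrightarrow> {v, s} \<in> independence_graph \<D>"
      "clique_bounded (independence_graph \<D>) H"
  shows "\<exists>n''. (n, n'') \<in> exchange\<^sup>* \<and> n'' \<in> tables m I \<and> same_margins n'' n' \<and>
    (\<forall>j. agree_sum \<Omega> (insert v H) n'' j = agree_sum \<Omega> (insert v H) n' j)"
  using n H(2)
proof (induction "nat (\<Sum>j\<in>cells I (insert v H). \<bar>agree_sum \<Omega> (insert v H) (n - n') j\<bar>)"
    arbitrary: n rule: less_induct)
  case less
  show ?case
  proof (cases "\<forall>j. agree_sum \<Omega> (insert v H) n j = agree_sum \<Omega> (insert v H) n' j")
    case True
    then show ?thesis using less.prems by blast
  next
    case False
    then obtain j0 where "agree_sum \<Omega> (insert v H) n j0 \<noteq> agree_sum \<Omega> (insert v H) n' j0" by blast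
    from exchange_step[OF less.prems(1-3) H(1) less.prems(4) v this]
    obtain n1 where n1: "(n, n1) \<in> exchange" "\<And>j. agree_sum \<Omega> H n1 j = agree_sum \<Omega> H n j"
      "(\<Sum>j\<in>cells I (insert v H). \<bar>agree_sum \<Omega> (insert v H) (n1 - n') j\<bar>) <
       (\<Sum>j\<in>cells I (insert v H). \<bar>agree_sum \<Omega> (insert v H) (n - n') j\<bar>)"
      by blast
    have "0 \<le> (\<Sum>j\<in>cells I (insert v H). \<bar>agree_sum \<Omega> (insert v H) (n1 - n') j\<bar>)"
      by (intro sum_nonneg) simp
    with n1(3) have "nat (\<Sum>j\<in>cells I (insert v H). \<bar>agree_sum \<Omega> (insert v H) (n1 - n') j\<bar>) <
        nat (\<Sum>j\<in>cells I (insert v H). \<bar>agree_sum \<Omega> (insert v H) (n - n') j\<bar>)"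
      by linarith
    then have "\<exists>n''. (n1, n'') \<in> exchange\<^sup>* \<and> n'' \<in> tables m I \<and> same_margins n'' n' \<and>
      (\<forall>j. agree_sum \<Omega> (insert v H) n'' j = agree_sum \<Omega> (insert v H) n' j)"
      using exchange_preserves[OF n1(1)] less.prems n1(2)
      by (intro less.hyps) simp_all
    then show ?thesis using n1(1) by (meson converse_rtrancl_into_rtrancl)
  qed
qed

text \<open>Induction on the number of variables outside \<open>H\<close>; a common neighbour of the
  boundary of some component is added each time. Once \<open>H\<close> is everything, margins are
  single entries.\<close>

lemma exchange_connected_from:
  assumes "n \<in> tables m I" "n' \<in> tables m I" "same_margins n n'"
    and "H \<subseteq> {1..m}" "\<And>j. agree_sum \<Omega> H n j = agree_sum \<Omega> H n' j"
    and "clique_bounded (independence_graph \<D>) H"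
  shows "(n, n') \<in> exchange\<^sup>*"
  using assms
proof (induction "card ({1..m} - H)" arbitrary: n H rule: less_induct)
  case less
  show ?case
  proof (cases "H = {1..m}")
    case True
    have "n k = n' k" for k
    proof (cases "k \<in> \<Omega>")
      case k: True
      have "{l \<in> \<Omega>. \<forall>d\<in>{1..m}. l d = k d} = {k}"
        using k by (auto simp: \<Omega>_def cells_def intro: PiE_ext)
      then show ?thesis using less.prems(5)[of k] True by (simp add: agree_sum_def)
    next
      case False
      then show ?thesis using less.prems(1,2) by (simp add: \<Omega>_def tables_def arrays_def)
    qed
    then have "n = n'" by blast
    then show ?thesis by simp
  next
    case False
    let ?E = "independence_graph \<D>"
    obtain x where x: "x \<in> {1..m}" "x \<notin> H" using False less.prems(4) by blast
    have "finite H" using less.prems(4) finite_subset by blast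
    then obtain v where v: "(x, v) \<in> (outside ?E H)\<^sup>*" "\<And>s. s \<in> boundary ?E H x \<Longrightarrow> {v, s} \<in> ?E"
      using chordal_common_neighbour[OF chordal _ less.prems(6) x(2)] by blast
    have vH: "v \<notin> H" using outside_rtrancl_notin[OF v(1) x(2)] .
    \<comment> \<open>Edges join only variables, so the component of \<open>x\<close> cannot leave
      them.\<close>
    have "outside ?E H `` {1..m} \<subseteq> {1..m}"
      using Union_\<D> by (auto simp: outside_def independence_graph_def doubleton_eq_iff)
    then have vm: "v \<in> {1..m}"
      using x(1) Image_closed_trancl[of "outside ?E H" "{1..m}"] v(1) by blast
    have bd: "{v, s} \<in> ?E" if "s \<in> boundary ?E H v" for s
      using v that by (simp add: boundary_eq[OF v(1)])
    obtain n'' where n'': "(n, n'') \<in> exchange\<^sup>*" "n'' \<in> tables m I" "same_margins n'' n'"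
      "\<forall>j. agree_sum \<Omega> (insert v H) n'' j = agree_sum \<Omega> (insert v H) n' j"
      using exchange_extend[OF less.prems(1-5) vm vH bd less.prems(6)] by metis
    have "card ({1..m} - insert v H) < card ({1..m} - H)"
      using vm vH by (intro psubset_card_mono) (simp, blast)
    moreover have "insert v H \<subseteq> {1..m}" using less.prems(4) vm by blast
    moreover have "agree_sum \<Omega> (insert v H) n'' j = agree_sum \<Omega> (insert v H) n' j" for j
      using n''(4) by blast
    moreover have "clique_bounded ?E (insert v H)"
      using clique_bounded_insert[OF less.prems(6) vH bd] .
    ultimately have "(n'', n') \<in> exchange\<^sup>*"
      by (rule less.hyps[OF _ n''(2) less.prems(2) n''(3)])
    then show ?thesis using n''(1) by (rule rtrancl_trans[rotated])
  qed
qed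

text \<open>Starts from \<open>H = {}\<close>, whose margin is the sample size and follows from any
  facet margin; all boundaries in the empty set are empty.\<close>

theorem exchange_connected:
  assumes "n \<in> fiber m I \<D> b" "n' \<in> fiber m I \<D> b"
  shows "(n, n') \<in> exchange\<^sup>*"
proof -
  have same: "same_margins n n'"
    using assms margins_eq[of n n'] by (simp add: fiber_def)
  obtain D where D: "D \<in> \<D>" using decomposable_nonempty[OF decomp] by blast
  have "agree_sum \<Omega> {} (n - n') j = 0" for j
    by (rule agree_sum_zero_mono[OF finite_\<Omega>, of _ D]) (use same D in \<open>simp_all add: agree_sum_diff\<close>)
  then show ?thesis
    using assms same
    by (intro exchange_connected_from[where H = "{}"])
      (auto simp: fiber_def agree_sum_diff clique_bounded_def clique_def boundary_def)
qed

subsection \<open>Fibers of degree two\<close>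

lemma finite_fiber_model: "finite (fiber m I \<D> b)"
  using finite_fiber generating decomposable_nonempty[OF decomp] by blast

lemma deg_fiber: "n \<in> fiber m I \<D> b \<Longrightarrow> deg m I \<D> b = sample_size m I n"
  using deg_eq_sample_size generating decomposable_nonempty[OF decomp] by blast

lemma fiber_iff: "n \<in> fiber m I \<D> b \<longleftrightarrow> n \<in> tables m I \<and> margins m I \<D> n = b"
  by (simp add: fiber_def)

lemma B_ndI:
  assumes "p \<in> tables m I" "p' \<in> tables m I" "sample_size m I p = 2"
    "margins m I \<D> p = margins m I \<D> p'" "p \<noteq> p'"
  shows "margins m I \<D> p \<in> B_nd m I \<D>"
proof -
  have sub: "{p, p'} \<subseteq> fiber m I \<D> (margins m I \<D> p)"
    using assms by (simp add: fiber_iff)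
  have "2 \<le> card (fiber m I \<D> (margins m I \<D> p))"
    using card_mono[OF finite_fiber_model sub] assms(5) by simp
  moreover have "deg m I \<D> (margins m I \<D> p) = 2"
    using deg_fiber[of p] sub assms(3) by simp
  ultimately show ?thesis by (simp add: B_nd_def)
qed

lemma table_of_size_one:
  assumes "q \<in> tables m I" "sample_size m I q = 1"
  obtains i where "i \<in> \<Omega>" "q = unit_table i"
proof -
  have nonneg: "0 \<le> q k" for k using assms(1) by (simp add: tables_def)
  have size: "sum q \<Omega> = 1" using assms(2) by (simp add: sample_size_def \<Omega>_def)
  then obtain i where i: "i \<in> \<Omega>" "q i \<noteq> 0" by (metis sum.neutral zero_neq_one)
  have split: "q i + sum q (\<Omega> - {i}) = 1"
    using size sum.remove[OF finite_\<Omega> i(1), of q] by simp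
  have "0 \<le> sum q (\<Omega> - {i})" using nonneg by (simp add: sum_nonneg)
  then have qi: "q i = 1" "sum q (\<Omega> - {i}) = 0"
    using split nonneg[of i] i(2) by linarith+
  have "q k = unit_table i k" for k
  proof (cases "k \<in> \<Omega> - {i}")
    case True
    then show ?thesis
      using qi(2) sum_nonneg_eq_0_iff[of "\<Omega> - {i}" q] nonneg finite_\<Omega> by (simp add: unit_table_def)
  next
    case False
    then show ?thesis
      using qi(1) assms(1) by (auto simp: unit_table_def \<Omega>_def tables_def arrays_def)
  qed
  then show ?thesis using i(1) by (intro that) auto
qed

text \<open>The facets cover all variables, so the margins of a single cell reveal each of its
  levels.\<close>

lemma unit_table_margins_inj:
  assumes "i \<in> \<Omega>" "j \<in> \<Omega>" "same_margins (unit_table i) (unit_table j)"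
  shows "i = j"
proof (rule PiE_ext)
  show "i \<in> (\<Pi>\<^sub>E d\<in>{1..m}. {0..<I d})" "j \<in> (\<Pi>\<^sub>E d\<in>{1..m}. {0..<I d})"
    using assms(1,2) by (simp_all add: \<Omega>_def cells_def)
  fix d assume "d \<in> {1..m}"
  then obtain D where D: "D \<in> \<D>" "d \<in> D" using Union_\<D> by blast
  have "agree_sum \<Omega> D (unit_table j) i = agree_sum \<Omega> D (unit_table i) i"
    using assms(3) D(1) by simp
  then show "i d = j d"
    using assms(1,2) D(2) by (simp add: agree_sum_unit_table finite_\<Omega> split: if_splits)
qed

text \<open>A common cell could be taken out of both tables, leaving single cells with equal
  margins, which must coincide.\<close>

lemma disjoint_supports:
  assumes "p \<in> tables m I" "p' \<in> tables m I" "sample_size m I p = 2" "sample_size m I p' = 2"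
    "margins m I \<D> p = margins m I \<D> p'" "p \<noteq> p'"
  shows "p k = 0 \<or> p' k = 0"
proof (rule ccontr)
  assume "\<not> ?thesis"
  moreover have "0 \<le> p k" "0 \<le> p' k" using assms(1,2) by (simp_all add: tables_def)
  ultimately have pos: "1 \<le> p k" "1 \<le> p' k" by linarith+
  have k: "k \<in> \<Omega>" using pos(1) assms(1) by (force simp: tables_def arrays_def \<Omega>_def)
  have size: "sample_size m I (unit_table k) = 1"
    using k by (simp add: sample_size_eq_agree_sum[of _ undefined] agree_sum_unit_table finite_\<Omega>)
  have reduced: "x - unit_table k \<in> tables m I" "sample_size m I (x - unit_table k) = 1"
    if "x \<in> tables m I" "sample_size m I x = 2" "1 \<le> x k" for x
    using that size k
    by (auto simp: tables_def arrays_def unit_table_def sample_size_eq_agree_sum[of _ undefined]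
        agree_sum_diff \<Omega>_def)
  obtain i where i: "i \<in> \<Omega>" "p - unit_table k = unit_table i"
    using table_of_size_one reduced[OF assms(1,3) pos(1)] by blast
  obtain j where j: "j \<in> \<Omega>" "p' - unit_table k = unit_table j"
    using table_of_size_one reduced[OF assms(2,4) pos(2)] by blast
  have "same_margins (unit_table i) (unit_table j)"
    using assms(5) unfolding margins_eq i(2)[symmetric] j(2)[symmetric] by (simp add: agree_sum_diff)
  then have "p - unit_table k = p' - unit_table k"
    using unit_table_margins_inj[OF i(1) j(1)] i(2) j(2) by simp
  then show False using assms(6) by simp
qed

lemma B_nd_fiberD:
  assumes "b \<in> B_nd m I \<D>" "x \<in> fiber m I \<D> b"
  shows "x \<in> tables m I" "margins m I \<D> x = b" "sample_size m I x = 2"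
  using assms deg_fiber[OF assms(2)] by (auto simp: fiber_iff B_nd_def)

text \<open>Since the supports are disjoint, two tables in a fiber of degree two are the positive and
  the negative part of their difference.\<close>

lemma edge_determined_by_move:
  assumes b: "b \<in> B_nd m I \<D>" "x \<in> fiber m I \<D> b" "y \<in> fiber m I \<D> b" "x \<noteq> y"
    and c: "c \<in> B_nd m I \<D>" "u \<in> fiber m I \<D> c" "w \<in> fiber m I \<D> c" "u \<noteq> w"
    and eq: "up_to_sign (x - y) = up_to_sign (u - w)"
  shows "b = c \<and> {x, y} = {u, w}"
proof -
  have parts: "x = u \<and> y = w"
    if "x \<in> fiber m I \<D> b" "y \<in> fiber m I \<D> b" "x \<noteq> y" "b \<in> B_nd m I \<D>"
      "u \<in> fiber m I \<D> c" "w \<in> fiber m I \<D> c" "u \<noteq> w" "c \<in> B_nd m I \<D>" "x - y = u - w"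
    for x y u w b c
  proof -
    have "x k = u k \<and> y k = w k" for k
    proof -
      have "x k = 0 \<or> y k = 0" "u k = 0 \<or> w k = 0"
        using that B_nd_fiberD by (metis disjoint_supports)+
      moreover have "0 \<le> x k" "0 \<le> y k" "0 \<le> u k" "0 \<le> w k"
        using that by (auto simp: fiber_iff tables_def)
      moreover have "x k - y k = u k - w k" using fun_cong[OF that(9), of k] by simp
      ultimately show ?thesis by linarith
    qed
    then show ?thesis by blast
  qed
  from eq consider "x - y = u - w" | "x - y = w - u"
    by (auto simp: up_to_sign_eq_iff)
  then show ?thesis
  proof cases
    case 1
    then have "x = u \<and> y = w" by (intro parts[OF b(2-4,1) c(2-4,1)])
    then show ?thesis using B_nd_fiberD(2) b c by metis
  next
    case 2
    then have "x = w \<and> y = u" by (intro parts[OF b(2-4,1) c(3,2) c(4)[symmetric] c(1)])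
    then show ?thesis using B_nd_fiberD(2) b c by (metis insert_commute)
  qed
qed

lemma diff_in_moves:
  assumes "x \<in> fiber m I \<D> b" "y \<in> fiber m I \<D> b"
  shows "x - y \<in> moves m I \<D>"
proof -
  have "same_margins x y" using assms margins_eq[of x y] by (simp add: fiber_iff)
  then have "same_margins (x - y) 0" by (simp add: agree_sum_diff) (simp add: agree_sum_def)
  then have "margins m I \<D> (x - y) = margins m I \<D> 0" by (simp add: margins_eq)
  then show ?thesis
    using assms margins_zero by (auto simp: moves_def fiber_iff tables_def arrays_def)
qed

text \<open>Bounds the edge moves of all fibers at once, since each is a difference of two tables of
  size two.\<close>

lemma finite_tables_of_size: "finite {n \<in> tables m I. sample_size m I n = s}" (is "finite ?Z")
proof -
  have "n i \<in> {0..s}" if n: "n \<in> ?Z" and i: "i \<in> \<Omega>" for n i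
  proof -
    have pos: "0 \<le> n k" for k using n by (auto simp: tables_def)
    then have "n i \<le> sum n \<Omega>" by (intro member_le_sum i finite_\<Omega>) auto
    then show ?thesis using pos n by (simp add: sample_size_def \<Omega>_def)
  qed
  then have "?Z \<subseteq> {n. \<forall>i. (i \<in> \<Omega> \<longrightarrow> n i \<in> {0..s}) \<and> (i \<notin> \<Omega> \<longrightarrow> n i = 0)}"
    by (auto simp: tables_def arrays_def \<Omega>_def)
  then show ?thesis
    by (rule finite_subset) (intro finite_set_of_finite_funs finite_\<Omega>; simp)
qed

section \<open>Markov bases and trees\<close>

lemma simple_graph_edge:
  assumes "simple_graph V E" "{x, y} \<in> E"
  shows "x \<in> V" "y \<in> V" "x \<noteq> y"
  using assms by (force simp: simple_graph_def doubleton_eq_iff)+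

text \<open>Each exchange from \<open>p\<close> to \<open>p'\<close> is replaced by a path from
  \<open>p\<close> to \<open>p'\<close> in the graph on their fiber, translated by the remainder
  \<open>q\<close>. Sums with \<open>q\<close> stay nonnegative and in the original fiber.\<close>

lemma markov_basis_of_connected_graphs:
  assumes simple: "\<And>b. b \<in> B_nd m I \<D> \<Longrightarrow> simple_graph (fiber m I \<D> b) (T b)"
    and conn: "\<And>b. b \<in> B_nd m I \<D> \<Longrightarrow> connected_graph (fiber m I \<D> b) (T b)"
  shows "markov_basis m I \<D> (\<Union>b\<in>B_nd m I \<D>. edge_moves (T b))" (is "markov_basis _ _ _ ?M")
proof -
  let ?Z = "{n \<in> tables m I. sample_size m I n = 2}"
  have edge: "x \<in> fiber m I \<D> b" "y \<in> fiber m I \<D> b" if "{x, y} \<in> T b" "b \<in> B_nd m I \<D>" for x y b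
    using simple_graph_edge[OF simple] that by blast+
  have "?M \<subseteq> (\<lambda>(x, y). up_to_sign (x - y)) ` (?Z \<times> ?Z)"
    using edge B_nd_fiberD by (fastforce simp: edge_moves_def)
  then have "finite ?M"
    by (rule finite_subset) (intro finite_imageI finite_cartesian_product finite_tables_of_size)
  moreover have "?M \<subseteq> up_to_sign ` moves m I \<D>"
    using edge diff_in_moves by (fastforce simp: edge_moves_def)
  moreover have "(n, n') \<in> {(x, y). x \<in> fiber m I \<D> b \<and> y \<in> fiber m I \<D> b \<and> up_to_sign (x - y) \<in> ?M}\<^sup>*"
    (is "_ \<in> ?R\<^sup>*") if n: "n \<in> fiber m I \<D> b" "n' \<in> fiber m I \<D> b" for n n' b
  proof -
    have "y \<in> fiber m I \<D> b \<and> (n, y) \<in> ?R\<^sup>*" if "(n, y) \<in> exchange\<^sup>*" for y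
      using that
    proof (induction rule: rtrancl_induct)
      case base
      then show ?case using n by simp
    next
      case (step x y)
      have x: "x \<in> fiber m I \<D> b" "(n, x) \<in> ?R\<^sup>*" using step.IH by blast+
      obtain q p p' where *: "x = q + p" "y = q + p'" "q \<in> tables m I" "p \<in> tables m I"
        "p' \<in> tables m I" "sample_size m I p = 2" "margins m I \<D> p = margins m I \<D> p'"
        using step.hyps(2) unfolding exchange_def by blast
      define c where "c = margins m I \<D> p"
      have p: "p \<in> fiber m I \<D> c" "p' \<in> fiber m I \<D> c"
        using * by (auto simp: fiber_iff c_def)
      have shift: "q + r \<in> fiber m I \<D> b" if "r \<in> fiber m I \<D> c" for r
      proof -
        have "same_margins (q + r) (q + p)"
          using that margins_eq[of r p] by (simp add: agree_sum_add fiber_iff c_def)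
        then have "margins m I \<D> (q + r) = b"
          using x(1) *(1) by (simp add: fiber_iff flip: margins_eq)
        then show ?thesis using that *(3) by (simp add: fiber_iff add_in_tables)
      qed
      have "(q + p, q + p') \<in> ?R\<^sup>*"
      proof (cases "p = p'")
        case False
        then have c: "c \<in> B_nd m I \<D>" unfolding c_def using * by (intro B_ndI)
        have "(p, p') \<in> {(x, y). {x, y} \<in> T c}\<^sup>*"
          using conn[OF c] p by (simp add: connected_graph_def)
        then show ?thesis
        proof (induction rule: rtrancl_induct)
          case (step r s)
          then have rs: "{r, s} \<in> T c" by simp
          have "up_to_sign (q + r - (q + s)) \<in> ?M"
            using rs c by (auto simp: edge_moves_def)
          then have "(q + r, q + s) \<in> ?R" using shift edge[OF rs c] by blast
          then show ?case using step.IH by (rule rtrancl_into_rtrancl[rotated])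
        qed simp
      qed simp
      then have "(n, q + p') \<in> ?R\<^sup>*" using x(2) *(1) by (meson rtrancl_trans)
      then show ?case unfolding *(2) using shift[OF p(2)] by blast
    qed
    then show ?thesis using exchange_connected[OF n] by blast
  qed
  ultimately show ?thesis unfolding markov_basis_def by blast
qed

text \<open>An edge move is nonzero, which supplies the distinctness of \<open>x\<close> and
  \<open>y\<close> needed to recover edge and fiber from the move.\<close>

lemma edge_moves_determines_edge:
  assumes trees: "\<And>b. b \<in> B_nd m I \<D> \<Longrightarrow> is_tree (fiber m I \<D> b) (T b)"
    and "b \<in> B_nd m I \<D>" "c \<in> B_nd m I \<D>" "x \<in> fiber m I \<D> b" "y \<in> fiber m I \<D> b"
    and "up_to_sign (x - y) \<in> edge_moves (T c)"
  shows "b = c \<and> {x, y} \<in> T c"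
proof -
  obtain u w where uw: "{u, w} \<in> T c" "up_to_sign (x - y) = up_to_sign (u - w)"
    using assms(6) unfolding edge_moves_def by blast
  have s: "simple_graph (fiber m I \<D> c) (T c)" using trees[OF assms(3)] by (simp add: is_tree_def)
  note edge = simple_graph_edge[OF s uw(1)]
  have "x \<noteq> y" using uw(2) edge(3) by (auto simp: up_to_sign_eq_iff)
  then show ?thesis
    using edge_determined_by_move[OF assms(2,4,5) _ assms(3) edge uw(2)] uw(1)
    by (metis (full_types))
qed

text \<open>If a smaller basis misses the move of a tree edge, its steps within that fiber all run
  along the other tree edges, but the missing edge is a bridge.\<close>

lemma trees_minimal:
  assumes trees: "\<And>b. b \<in> B_nd m I \<D> \<Longrightarrow> is_tree (fiber m I \<D> b) (T b)"
  shows "minimal_markov_basis m I \<D> (\<Union>b\<in>B_nd m I \<D>. edge_moves (T b))"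
    (is "minimal_markov_basis _ _ _ ?M")
  unfolding minimal_markov_basis_def
proof (intro conjI allI impI notI)
  have simple: "simple_graph (fiber m I \<D> b) (T b)" if "b \<in> B_nd m I \<D>" for b
    using trees[OF that] by (simp add: is_tree_def)
  show "markov_basis m I \<D> ?M"
    using trees by (intro markov_basis_of_connected_graphs) (auto simp: is_tree_def)
  fix M' assume sub: "M' \<subset> ?M" and M': "markov_basis m I \<D> M'"
  then obtain b x y where b: "b \<in> B_nd m I \<D>" and xy: "{x, y} \<in> T b"
    and out: "up_to_sign (x - y) \<notin> M'"
    unfolding edge_moves_def by blast
  have fib: "x \<in> fiber m I \<D> b" "y \<in> fiber m I \<D> b"
    using simple_graph_edge[OF simple[OF b] xy] by blast+
  have "(x, y) \<in> {(u, w). u \<in> fiber m I \<D> b \<and> w \<in> fiber m I \<D> b \<and> up_to_sign (u - w) \<in> M'}\<^sup>*"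
    using M' fib unfolding markov_basis_def by blast
  moreover have "{(u, w). u \<in> fiber m I \<D> b \<and> w \<in> fiber m I \<D> b \<and> up_to_sign (u - w) \<in> M'}
      \<subseteq> {(u, w). {u, w} \<in> T b - {{x, y}}}"
  proof clarify
    fix u w assume uw: "u \<in> fiber m I \<D> b" "w \<in> fiber m I \<D> b" "up_to_sign (u - w) \<in> M'"
    then obtain c where "c \<in> B_nd m I \<D>" "up_to_sign (u - w) \<in> edge_moves (T c)"
      using sub by blast
    then have "{u, w} \<in> T b" using edge_moves_determines_edge[OF trees b] uw(1,2) by blast
    moreover have "{u, w} \<noteq> {x, y}" using up_to_sign_doubleton uw(3) out by metis
    ultimately show "{u, w} \<in> T b - {{x, y}}" by blast
  qed
  ultimately have "(x, y) \<in> {(u, w). {u, w} \<in> T b - {{x, y}}}\<^sup>*"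
    using rtrancl_mono by blast
  then show False using tree_edge_bridge[OF trees[OF b] xy] by blast
qed

lemma trees_disjoint:
  assumes trees: "\<And>b. b \<in> B_nd m I \<D> \<Longrightarrow> is_tree (fiber m I \<D> b) (T b)"
  shows "disjoint_family_on (\<lambda>b. edge_moves (T b)) (B_nd m I \<D>)"
  unfolding disjoint_family_on_def
proof (intro ballI impI, rule ccontr)
  fix b c assume bc: "b \<in> B_nd m I \<D>" "c \<in> B_nd m I \<D>" "b \<noteq> c"
    and "edge_moves (T b) \<inter> edge_moves (T c) \<noteq> {}"
  then obtain x y where xy: "{x, y} \<in> T b" "up_to_sign (x - y) \<in> edge_moves (T c)"
    unfolding edge_moves_def by blast
  have "simple_graph (fiber m I \<D> b) (T b)" using trees[OF bc(1)] by (simp add: is_tree_def)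
  from simple_graph_edge[OF this xy(1)] have "x \<in> fiber m I \<D> b" "y \<in> fiber m I \<D> b" by blast+
  then show False using edge_moves_determines_edge[OF trees bc(1,2) _ _ xy(2)] bc(3) by blast
qed

text \<open>Spanning trees of the graphs that \<open>M\<close> induces on the fibers of degree two
  already give a Markov basis inside \<open>M\<close>, so minimality forces equality.\<close>

lemma minimal_markov_basis_trees:
  assumes min: "minimal_markov_basis m I \<D> M"
  shows "\<exists>T. (\<forall>b\<in>B_nd m I \<D>. is_tree (fiber m I \<D> b) (T b)) \<and>
    M = (\<Union>b\<in>B_nd m I \<D>. edge_moves (T b))"
proof -
  define G where "G b = {{x, y} | x y. x \<in> fiber m I \<D> b \<and> y \<in> fiber m I \<D> b \<and> x \<noteq> y \<and>
    up_to_sign (x - y) \<in> M}" for b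
  have "\<exists>F. F \<subseteq> G b \<and> is_tree (fiber m I \<D> b) F" if b: "b \<in> B_nd m I \<D>" for b
  proof -
    let ?R = "{(x, y). x \<in> fiber m I \<D> b \<and> y \<in> fiber m I \<D> b \<and> up_to_sign (x - y) \<in> M}"
    \<comment> \<open>\<open>G b\<close> has no loops; a step with \<open>x = y\<close> is absorbed
      by reflexivity.\<close>
    have "?R \<subseteq> {(x, y). {x, y} \<in> G b}\<^sup>*"
    proof clarify
      fix x y assume "x \<in> fiber m I \<D> b" "y \<in> fiber m I \<D> b" "up_to_sign (x - y) \<in> M"
      then show "(x, y) \<in> {(x, y). {x, y} \<in> G b}\<^sup>*"
        by (cases "x = y") (auto simp: G_def)
    qed
    then have "?R\<^sup>* \<subseteq> {(x, y). {x, y} \<in> G b}\<^sup>*"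
      by (rule rtrancl_subset_rtrancl)
    moreover have "fiber m I \<D> b \<noteq> {}" using b by (auto simp: B_nd_def)
    moreover have "\<forall>u\<in>fiber m I \<D> b. \<forall>v\<in>fiber m I \<D> b. (u, v) \<in> ?R\<^sup>*"
      using min unfolding minimal_markov_basis_def markov_basis_def by blast
    ultimately have "connected_graph (fiber m I \<D> b) (G b)"
      unfolding connected_graph_def by blast
    moreover have "simple_graph (fiber m I \<D> b) (G b)"
      unfolding simple_graph_def G_def by blast
    moreover have "finite (G b)"
      by (rule finite_subset[of _ "Pow (fiber m I \<D> b)"]) (auto simp: G_def finite_fiber_model)
    ultimately show ?thesis using spanning_tree by metis
  qed
  then obtain T where T: "\<And>b. b \<in> B_nd m I \<D> \<Longrightarrow> T b \<subseteq> G b"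
    "\<And>b. b \<in> B_nd m I \<D> \<Longrightarrow> is_tree (fiber m I \<D> b) (T b)"
    by metis
  have "(\<Union>b\<in>B_nd m I \<D>. edge_moves (T b)) \<subseteq> M"
  proof
    fix z assume "z \<in> (\<Union>b\<in>B_nd m I \<D>. edge_moves (T b))"
    then obtain b x y where "b \<in> B_nd m I \<D>" "z = up_to_sign (x - y)" "{x, y} \<in> T b"
      unfolding edge_moves_def by blast
    then obtain u w where "{x, y} = {u, w}" "up_to_sign (u - w) \<in> M"
      using T(1) unfolding G_def by blast
    then show "z \<in> M" using \<open>z = _\<close> up_to_sign_doubleton by metis
  qed
  moreover have "markov_basis m I \<D> (\<Union>b\<in>B_nd m I \<D>. edge_moves (T b))"
    using trees_minimal[OF T(2)] by (simp add: minimal_markov_basis_def)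
  ultimately have "M = (\<Union>b\<in>B_nd m I \<D>. edge_moves (T b))"
    using min unfolding minimal_markov_basis_def by blast
  then show ?thesis using T(2) by blast
qed

end

theorem theorem3:
  fixes m :: nat and I :: "nat \<Rightarrow> nat" and \<D> :: "nat set set"
  assumes "generating_class {1..m} \<D>"
    and "decomposable {1..m} \<D>"
  shows "(\<forall>T. (\<forall>b\<in>B_nd m I \<D>. is_tree (fiber m I \<D> b) (T b)) \<longrightarrow>
            minimal_markov_basis m I \<D> (\<Union>b\<in>B_nd m I \<D>. edge_moves (T b)) \<and>
            disjoint_family_on (\<lambda>b. edge_moves (T b)) (B_nd m I \<D>)) \<and>
         (\<forall>M. minimal_markov_basis m I \<D> M \<longrightarrow>
            (\<exists>T. (\<forall>b\<in>B_nd m I \<D>. is_tree (fiber m I \<D> b) (T b)) \<and>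
                 M = (\<Union>b\<in>B_nd m I \<D>. edge_moves (T b))))"
proof -
  interpret decomposable_model m I \<D> using assms by unfold_locales
  show ?thesis using trees_minimal trees_disjoint minimal_markov_basis_trees by blast
qed

end
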